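(* Let the mesh, edge quadrature, invariant domain, cell average decomposition, weak Lax–Friedrichs splitting, boundary data, conservative update and practical point update be as in the context. Let $\mathcal T:U_{\mathrm{fwd}}\to\mathbb R^m$ be a given forward map and $\mathcal B:\mathbb R^m\to G_{\mathrm{pt}}$ a globally defined admissibility-preserving inverse map with convex range $G_{\mathrm{pt}}\subseteq U_{\mathrm{fwd}}$. Suppose that the current point states satisfy $u_\sigma^n\in U_{\mathrm{fwd}}$ and that the resulting transformed stage values $w_\sigma^{n+1}=\mathcal T(u_\sigma^n)+\Delta t(\mathcal D^{\mathrm{pt}}(u_h^n))_\sigma\in\mathbb R^m$ are finite. Let $\bar u_K^n\in G$ for all $K$, $u_\sigma^n\in G_{\mathrm{pt}}$ for all $\sigma$, let $u_K^n=\mathcal R_K(u_h^n)$ be the associated reconstruction, and let $\hat u_K^n=\Pi_K(u_K^n;\bar u_K^n)$ be $G$-admissible. If $$\Delta t\le\min_{K\in\mathcal T_h}\frac{\mu_K}{2\alpha_K^n},\qquad\alpha_K^n:=\max_{e\in\mathcal E_K}\max_{\nu=1,\dots,N_q}\tilde\alpha\bigl(\hat u_K^n(x_{e,\nu}),n_{K,e}\bigr),$$ then one coupled forward Euler stage, with the conservative update for the cell averages and the point update $u_\sigma^{n+1}=\mathcal B(w_\sigma^{n+1})$, satisfies $\bar u_K^{n+1}\in G$ for all $K\in\mathcal T_h$ and $u_\sigma^{n+1}\in G_{\mathrm{pt}}$ for all $\sigma\in\Sigma_h$.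
   Context: PDE: $\partial_tu+\sum_{i=1}^2\partial_{x_i}f_i(u)=0$, hyperbolic, $u\in\mathbb R^m$; $A_i=Df_i$; $F(u)\cdot n:=\sum_in_if_i(u)$. Mesh and data: $\Omega\subseteq\mathbb R^2$ is partitioned by a conforming, uniformly shape-regular mesh $\mathcal T_h$ of open convex polygonal cells $K$ with uniformly bounded number of edges; $|K|$ area, $\mathcal E_K$ edges, $|e|$ length, $n_{K,e}$ outward unit normal, $K_e$ neighbour across $e$. $\Sigma_h$ is a finite set of nodes $\sigma$ (coordinates $x_\sigma$; vertices and edge midpoints), $\Sigma_K=\{\sigma:x_\sigma\in\partial K\}$. A hybrid state is $u_h=((\bar u_K)_K,(u_\sigma)_\sigma)$. $\mathbb W_K\supseteq(\mathbb P^k(K))^m$ is a finite-dimensional space of smooth functions; $u_K=\mathcal R_K(u_h)\in\mathbb W_K$ satisfies $\frac1{|K|}\int_Ku_K=\bar u_K$, $u_K(x_\sigma)=u_\sigma$ ($\sigma\in\Sigma_K$). Edge quadrature: nodes $x_{e,\nu}\in e\cap\{x_\sigma\}$, weights $\omega_{e,\nu}>0$, $\sum_{\nu=1}^{N_q}\omega_{e,\nu}=1$, exact for edge averages of functions in $\mathbb W_K$. Invariant domain: $\mathcal J$ finite; $G=\{u:g_j(u)\ge0\ \forall j\in\mathcal J\}$ convex, the closure of $\{u:g_j(u)>0\ \forall j\}$, $g_j$ concave, $C^1$ on an open set containing $G$; $S_j=\partial G\cap\partial\{g_j\ge0\}$, $n_j^*=\nabla g_j(u_j^* )\ne0$ for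 $u_j^*\in S_j$; $G=\{u:(u-u_j^* )\cdot n_j^*\ge0\ \forall u_j^*\in S_j,\forall j\}$. Cell average decomposition (CAD): with $\mathbb V_K\in\{(\mathbb P^k(K))^m,\mathbb W_K\}$ there are $\lambda_{K,e},\beta_{K,s}>0$ with total sum $1$ and $x_{K,s}^*\in\overline K$ with $\frac1{|K|}\int_K\phi=\sum_e\lambda_{K,e}\frac1{|e|}\int_e\phi\,ds+\sum_s\beta_{K,s}\phi(x_{K,s}^* )$ for all $\phi\in\mathbb V_K$; $\mu_K=\min_e\lambda_{K,e}|K|/|e|$. $\hat u_K\in\mathbb W_K$ is $G$-admissible if $\hat u_K(x_{e,\nu})\in G$ for all $e,\nu$ and, when $\sum_e\lambda_{K,e}<1$, $(\bar u_K-\sum_e\lambda_{K,e}\sum_\nu\omega_{e,\nu}\hat u_K(x_{e,\nu}))/(1-\sum_e\lambda_{K,e})\in G$. Limiter: $\Pi_K(u_K;\bar u_K)=\bar u_K+\theta_K(u_K-\bar u_K)$, where either (classic limiter, CAD on $\mathbb V_K=\mathbb W_K$) $\theta_K$ is the supremum of $\theta\in[0,1]$ with $\bar u_K+\theta(u_K(x)-\bar u_K)\in G$ for all $x\in\{x_{e,\nu}\}\cup\{x^*_{K,s}\}$, or (alternative limiter, CAD on $\mathbb V_K=(\mathbb P^k(K))^m$) $\theta_K$ is the supremum of $\theta\in[0,1]$ with $\bar u_K+\theta(u_K(x_{e,\nu})-\bar u_K)\in G$ for all $e,\nu$ and, if $\sum_e\lambda_{K,e}<1$, also $\bar u_K+\theta(u_K^*-\bar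 u_K)\in G$, with $u_K^*=(\bar u_K-\sum_e\lambda_{K,e}\frac1{|e|}\int_eu_K\,ds)/(1-\sum_e\lambda_{K,e})$. Weak Lax–Friedrichs splitting: for every $u\in G$, unit $n$ there is a wave-speed bound $\tilde\alpha(u,n)\ge0$, and for every $j$, $u_j^*\in S_j$ a vector $\zeta(u_j^* )\in\mathbb R^2$ with $\alpha(u-u_j^* )\cdot n_j^*\pm(F(u)\cdot n)\cdot n_j^*\ge\mp\zeta(u_j^* )\cdot n$ for all unit $n$ and $\alpha\ge\tilde\alpha(u,n)$. Conservative update: $\bar u_K^{n+1}=\bar u_K^n-\frac{\Delta t}{|K|}\sum_e|e|\sum_\nu\omega_{e,\nu}\bigl(\frac12[F(\hat u^n_{K,e,\nu})+F(\hat u^n_{K_e,e,\nu})]\cdot n_{K,e}-\frac{\alpha_{K,e,\nu}}2(\hat u^n_{K_e,e,\nu}-\hat u^n_{K,e,\nu})\bigr)$, with $\hat u^n_{K,e,\nu}=\hat u^n_K(x_{e,\nu})$, $\hat u^n_{K_e,e,\nu}=\hat u^n_{K_e}(x_{e,\nu})$ (a prescribed state in $G$ on boundary edges) and $\alpha_{K,e,\nu}\ge\max\{\tilde\alpha(\hat u^n_{K,e,\nu},n_{K,e}),\tilde\alpha(\hat u^n_{K_e,e,\nu},n_{K,e})\}$. Point operator: $J_q=D\mathcal T(\sum_iq_iA_i)(D\mathcal T)^{-1}$, $\partial_qw_{K,\sigma}=D\mathcal T(u_\sigma)(q\cdot\nabla u_K(x_\sigma))$. For $\sigma\in\Sigma_h$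 let $\mathcal E_\sigma$ be the edges containing $x_\sigma$; for $e\in\mathcal E_\sigma$, $\tau_{\sigma,e}$ is the unit tangent away from $x_\sigma$, $(n_{\sigma,e},\tau_{\sigma,e})$ a right-handed orthonormal basis, $n_{\sigma,e}$ pointing from cell $K^-_{\sigma,e}$ to $K^+_{\sigma,e}$; for a vertex, $K^{\mathrm{ext}}_{\sigma,e}$ is the cell containing $x_\sigma-\varepsilon\tau_{\sigma,e}$ for small $\varepsilon>0$ (ties broken deterministically). $\omega_{\sigma,e}=\theta_{\sigma,e}/\sum_{e'}\theta_{\sigma,e'}$, $\theta_{\sigma,e}$ being half the sum of the interior angles at $\sigma$ of the cells adjacent to $e$. $\alpha_\sigma>0$ bounds the spectral radii of $J_{n_{\sigma,e}}(u_\sigma),J_{\tau_{\sigma,e}}(u_\sigma)$; $J_q^\pm=\frac12(J_q(u_\sigma)\pm\alpha_\sigma I)$. For a vertex, $(\mathcal D^{\mathrm{pt}}(u_h))_\sigma=-\sum_{e\in\mathcal E_\sigma}\omega_{\sigma,e}(J^+_{n_{\sigma,e}}\partial_{n_{\sigma,e}}w_{K^-_{\sigma,e},\sigma}+J^-_{n_{\sigma,e}}\partial_{n_{\sigma,e}}w_{K^+_{\sigma,e},\sigma}+J^-_{\tau_{\sigma,e}}\partial_{\tau_{\sigma,e}}w_{K^-_{\sigma,e},\sigma}+J^+_{\tau_{\sigma,e}}\partial_{\tau_{\sigma,e}}w_{K^{\mathrm{ext}}_{\sigma,e},\sigma})$; for the midpoint of $e$, $(\mathcal D^{\mathrm{pt}}(u_h))_\sigma=-(J^+_{n_{\sigma,e}}\partial_{n_{\sigma,e}}w_{K^-_{\sigma,e},\sigma}+J^-_{n_{\sigma,e}}\partial_{n_{\sigma,e}}w_{K^+_{\sigma,e},\sigma}+J_{\tau_{\sigma,e}}\partial_{\tau_{\sigma,e}}w_{K^-_{\sigma,e},\sigma})$.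 Missing exterior traces and derivatives at the boundary are supplied by the boundary conditions, consistently with the physical boundary data and in a locally Lipschitz manner.
   Formalization: Two added hypotheses, without which the claim fails: Δt·α_{K,e,ν} ≤ μ_K for the viscosities used in the flux (α_K^n sees only the cell's own traces), and, when the edge weights λ_{K,e} sum to 1, the cell average decomposition must hold on all of W_K. *)

theory Defs
  imports "HOL-Analysis.Analysis"
begin

section \<open>Mesh\<close>

text \<open>Nodes are identified with their coordinates, so a node is a point of the plane. A hybrid state
  is a pair (cell averages, point values); only its values on the cells and nodes of the mesh matter.\<close>

type_synonym point = "real^2"
type_synonym cell = "point set"
type_synonym edge = "point set"
type_synonym 'm field = "point \<Rightarrow> real^'m"
type_synonym 'm hybrid = "(cell \<Rightarrow> real^'m) \<times> (point \<Rightarrow> real^'m)"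

definition open_convex_polygon :: "cell \<Rightarrow> bool" where
  "open_convex_polygon K \<longleftrightarrow> open K \<and> convex K \<and> K \<noteq> {} \<and> polytope (closure K)"

definition cell_edges :: "cell \<Rightarrow> edge set" where
  "cell_edges K = {e. e edge_of closure K}"

definition cell_vertices :: "cell \<Rightarrow> point set" where
  "cell_vertices K = {v. v extreme_point_of closure K}"

definition mesh_edges :: "cell set \<Rightarrow> edge set" where
  "mesh_edges \<T> = (\<Union>K\<in>\<T>. cell_edges K)"

definition mesh_vertices :: "cell set \<Rightarrow> point set" where
  "mesh_vertices \<T> = (\<Union>K\<in>\<T>. cell_vertices K)"

definition edge_midpoints :: "cell set \<Rightarrow> point set" where
  "edge_midpoints \<T> = {midpoint a b | a b. closed_segment a b \<in> mesh_edges \<T>}"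

definition nodes :: "cell set \<Rightarrow> point set" where
  "nodes \<T> = mesh_vertices \<T> \<union> edge_midpoints \<T>"

definition cell_nodes :: "cell set \<Rightarrow> cell \<Rightarrow> point set" where
  "cell_nodes \<T> K = nodes \<T> \<inter> frontier K"

text \<open>In a conforming mesh the closures of two cells meet in a common face (empty, a vertex or a
  whole edge); the condition is symmetric because the two cells range over all pairs.\<close>

definition conforming_mesh :: "point set \<Rightarrow> cell set \<Rightarrow> bool" where
  "conforming_mesh \<Omega> \<T> \<longleftrightarrow>
     finite \<T> \<and> \<T> \<noteq> {} \<and> (\<forall>K\<in>\<T>. open_convex_polygon K) \<and>
     pairwise disjnt \<T> \<and> \<Omega> = interior (\<Union>K\<in>\<T>. closure K) \<and>
     (\<forall>K\<in>\<T>. \<forall>K'\<in>\<T>. (closure K \<inter> closure K') face_of closure K)"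

definition shape_regular :: "real \<Rightarrow> nat \<Rightarrow> cell set \<Rightarrow> bool" where
  "shape_regular \<rho> N \<T> \<longleftrightarrow> 0 < \<rho> \<and>
     (\<forall>K\<in>\<T>. (\<exists>x. ball x (\<rho> * diameter K) \<subseteq> K) \<and> card (cell_edges K) \<le> N)"

definition area :: "cell \<Rightarrow> real" where
  "area K = measure lebesgue K"

definition edge_length :: "edge \<Rightarrow> real" where
  "edge_length e = diameter e"

definition outward_normal :: "cell \<Rightarrow> edge \<Rightarrow> point" where
  "outward_normal K e = (THE n. norm n = 1 \<and> (\<forall>x\<in>e. \<forall>y\<in>K. (y - x) \<bullet> n < 0))"

text \<open>In a conforming mesh at most one cell lies across an edge, so the choice below is no choice.\<close>

definition has_neighbour :: "cell set \<Rightarrow> cell \<Rightarrow> edge \<Rightarrow> bool" where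
  "has_neighbour \<T> K e \<longleftrightarrow> (\<exists>K'\<in>\<T>. K' \<noteq> K \<and> e \<in> cell_edges K')"

definition neighbour :: "cell set \<Rightarrow> cell \<Rightarrow> edge \<Rightarrow> cell" where
  "neighbour \<T> K e = (SOME K'. K' \<in> \<T> \<and> K' \<noteq> K \<and> e \<in> cell_edges K')"

definition cell_avg :: "cell \<Rightarrow> 'm::finite field \<Rightarrow> real^'m" where
  "cell_avg K \<phi> = (1 / area K) *\<^sub>R integral K \<phi>"

text \<open>The affine parametrisation of an edge over the unit interval has constant speed equal to the
  edge length, so the integral below is the arc length integral divided by the edge length; it does
  not depend on the orientation of the edge.\<close>

definition edge_avg :: "edge \<Rightarrow> 'm::finite field \<Rightarrow> real^'m" where
  "edge_avg e \<phi> = (THE y. \<exists>a b. e = closed_segment a b \<and> y = integral {0..1} (\<lambda>t. \<phi> (linepath a b t)))"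

section \<open>Local spaces, reconstruction and quadrature\<close>

primrec Ck_on :: "nat \<Rightarrow> 'm::finite field \<Rightarrow> point set \<Rightarrow> bool" where
  "Ck_on 0 \<phi> S \<longleftrightarrow> continuous_on S \<phi>"
| "Ck_on (Suc r) \<phi> S \<longleftrightarrow> (\<forall>x\<in>S. \<phi> differentiable (at x)) \<and>
     (\<forall>v. Ck_on r (\<lambda>x. frechet_derivative \<phi> (at x) v) S)"

definition smooth_up_to_boundary :: "cell \<Rightarrow> 'm::finite field \<Rightarrow> bool" where
  "smooth_up_to_boundary K \<phi> \<longleftrightarrow> (\<exists>U. open U \<and> closure K \<subseteq> U \<and> (\<forall>r. Ck_on r \<phi> U))"

text \<open>Vector fields whose components are polynomials of total degree at most \<open>k\<close>.\<close>

definition poly_fields :: "nat \<Rightarrow> 'm::finite field set" where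
  "poly_fields k = {p. \<exists>c. p = (\<lambda>x. \<Sum>(a, b)\<in>{(a, b). a + b \<le> k}. (x$1 ^ a * x$2 ^ b) *\<^sub>R c (a, b))}"

text \<open>Fields are total functions on the plane, of which only the values near the closure of \<open>K\<close>
  are meaningful; a finite-dimensional space is the span of a finite set.\<close>

definition local_space :: "nat \<Rightarrow> cell \<Rightarrow> 'm::finite field set \<Rightarrow> bool" where
  "local_space k K W \<longleftrightarrow>
     (\<exists>B. finite B \<and> (\<forall>b\<in>B. smooth_up_to_boundary K b) \<and>
          W = {\<phi>. \<exists>c. \<phi> = (\<lambda>x. \<Sum>b\<in>B. c b *\<^sub>R b x)}) \<and>
     poly_fields k \<subseteq> W"

definition reconstruction ::
  "cell set \<Rightarrow> (cell \<Rightarrow> 'm::finite field set) \<Rightarrow> (cell \<Rightarrow> 'm hybrid \<Rightarrow> 'm field) \<Rightarrow> bool" where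
  "reconstruction \<T> \<W> \<R> \<longleftrightarrow>
     (\<forall>K\<in>\<T>. \<forall>v. \<R> K v \<in> \<W> K \<and> cell_avg K (\<R> K v) = fst v K \<and>
        (\<forall>\<sigma>\<in>cell_nodes \<T> K. \<R> K v \<sigma> = snd v \<sigma>))"

record quadrature =
  qn :: nat
  qx :: "edge \<Rightarrow> nat \<Rightarrow> point"
  qw :: "edge \<Rightarrow> nat \<Rightarrow> real"

definition edge_quadrature ::
  "cell set \<Rightarrow> (cell \<Rightarrow> 'm::finite field set) \<Rightarrow> quadrature \<Rightarrow> bool" where
  "edge_quadrature \<T> \<W> Q \<longleftrightarrow>
     (\<forall>e\<in>mesh_edges \<T>. (\<forall>\<nu>\<in>{1..qn Q}. qx Q e \<nu> \<in> e \<inter> nodes \<T> \<and> 0 < qw Q e \<nu>) \<and>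
        (\<Sum>\<nu>=1..qn Q. qw Q e \<nu>) = 1) \<and>
     (\<forall>K\<in>\<T>. \<forall>e\<in>cell_edges K. \<forall>\<phi>\<in>\<W> K.
        edge_avg e \<phi> = (\<Sum>\<nu>=1..qn Q. qw Q e \<nu> *\<^sub>R \<phi> (qx Q e \<nu>)))"

section \<open>Invariant domain and weak Lax--Friedrichs splitting\<close>

definition grad :: "(real^'m::finite \<Rightarrow> real) \<Rightarrow> real^'m \<Rightarrow> real^'m" where
  "grad g u = (THE d. GDERIV g u :> d)"

definition contact_set ::
  "(real^'m::finite) set \<Rightarrow> ('j \<Rightarrow> real^'m \<Rightarrow> real) \<Rightarrow> 'j \<Rightarrow> (real^'m) set" where
  "contact_set G g j = frontier G \<inter> frontier {u. 0 \<le> g j u}"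

definition invariant_domain ::
  "'j set \<Rightarrow> ('j \<Rightarrow> real^'m::finite \<Rightarrow> real) \<Rightarrow> (real^'m) set \<Rightarrow> bool" where
  "invariant_domain J g G \<longleftrightarrow>
     finite J \<and> G = {u. \<forall>j\<in>J. 0 \<le> g j u} \<and> convex G \<and> G = closure {u. \<forall>j\<in>J. 0 < g j u} \<and>
     (\<forall>j\<in>J. concave_on G (g j)) \<and>
     (\<exists>U. open U \<and> G \<subseteq> U \<and>
        (\<forall>j\<in>J. (\<forall>u\<in>U. GDERIV (g j) u :> grad (g j) u) \<and> continuous_on U (grad (g j)))) \<and>
     (\<forall>j\<in>J. \<forall>u\<in>contact_set G g j. grad (g j) u \<noteq> 0) \<and>
     G = {u. \<forall>j\<in>J. \<forall>us\<in>contact_set G g j. 0 \<le> (u - us) \<bullet> grad (g j) us}"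

definition normal_flux :: "(2 \<Rightarrow> real^'m::finite \<Rightarrow> real^'m) \<Rightarrow> real^'m \<Rightarrow> point \<Rightarrow> real^'m" where
  "normal_flux f u n = (\<Sum>i\<in>UNIV. n$i *\<^sub>R f i u)"

text \<open>The two inequalities are the upper and the lower sign of the splitting condition;
  the vector \<open>\<zeta> j us\<close> does not depend on \<open>u\<close>, \<open>n\<close> or \<open>\<alpha>\<close>.\<close>

definition weak_LF_splitting ::
  "'j set \<Rightarrow> ('j \<Rightarrow> real^'m::finite \<Rightarrow> real) \<Rightarrow> (real^'m) set \<Rightarrow> (2 \<Rightarrow> real^'m \<Rightarrow> real^'m) \<Rightarrow>
   (real^'m \<Rightarrow> point \<Rightarrow> real) \<Rightarrow> ('j \<Rightarrow> real^'m \<Rightarrow> point) \<Rightarrow> bool" where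
  "weak_LF_splitting J g G f ws \<zeta> \<longleftrightarrow>
     (\<forall>u\<in>G. \<forall>n. norm n = 1 \<longrightarrow> 0 \<le> ws u n) \<and>
     (\<forall>u\<in>G. \<forall>j\<in>J. \<forall>us\<in>contact_set G g j. \<forall>n \<alpha>. norm n = 1 \<and> ws u n \<le> \<alpha> \<longrightarrow>
        \<alpha> * ((u - us) \<bullet> grad (g j) us) + normal_flux f u n \<bullet> grad (g j) us \<ge> - (\<zeta> j us \<bullet> n) \<and>
        \<alpha> * ((u - us) \<bullet> grad (g j) us) - normal_flux f u n \<bullet> grad (g j) us \<ge> \<zeta> j us \<bullet> n)"

section \<open>Cell average decomposition and limiters\<close>

datatype limiter = Classic | Alternative

record cad =
  lam :: "cell \<Rightarrow> edge \<Rightarrow> real"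
  intn :: "cell \<Rightarrow> nat"
  bet :: "cell \<Rightarrow> nat \<Rightarrow> real"
  intx :: "cell \<Rightarrow> nat \<Rightarrow> point"

definition lam_sum :: "cad \<Rightarrow> cell \<Rightarrow> real" where
  "lam_sum C K = (\<Sum>e\<in>cell_edges K. lam C K e)"

definition cad_space ::
  "(cell \<Rightarrow> limiter) \<Rightarrow> nat \<Rightarrow> (cell \<Rightarrow> 'm::finite field set) \<Rightarrow> cell \<Rightarrow> 'm field set" where
  "cad_space lk k \<W> K = (case lk K of Classic \<Rightarrow> \<W> K | Alternative \<Rightarrow> poly_fields k)"

text \<open>There may be no interior points (\<open>intn C K = 0\<close>), in which case the edge weights add up to one.\<close>

definition cell_average_decomposition ::
  "cell set \<Rightarrow> (cell \<Rightarrow> 'm::finite field set) \<Rightarrow> cad \<Rightarrow> bool" where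
  "cell_average_decomposition \<T> V C \<longleftrightarrow>
     (\<forall>K\<in>\<T>. (\<forall>e\<in>cell_edges K. 0 < lam C K e) \<and>
        (\<forall>s<intn C K. 0 < bet C K s \<and> intx C K s \<in> closure K) \<and>
        lam_sum C K + (\<Sum>s<intn C K. bet C K s) = 1 \<and>
        (\<forall>\<phi>\<in>V K. cell_avg K \<phi> =
           (\<Sum>e\<in>cell_edges K. lam C K e *\<^sub>R edge_avg e \<phi>) +
           (\<Sum>s<intn C K. bet C K s *\<^sub>R \<phi> (intx C K s))))"

definition cad_mu :: "cad \<Rightarrow> cell \<Rightarrow> real" where
  "cad_mu C K = (MIN e\<in>cell_edges K. lam C K e * area K / edge_length e)"

definition G_admissible ::
  "(real^'m::finite) set \<Rightarrow> quadrature \<Rightarrow> cad \<Rightarrow> (cell \<Rightarrow> 'm field set) \<Rightarrow> cell \<Rightarrow> real^'m \<Rightarrow> 'm field \<Rightarrow> bool"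
  where
  "G_admissible G Q C \<W> K ubar uh \<longleftrightarrow>
     uh \<in> \<W> K \<and> (\<forall>e\<in>cell_edges K. \<forall>\<nu>\<in>{1..qn Q}. uh (qx Q e \<nu>) \<in> G) \<and>
     (lam_sum C K < 1 \<longrightarrow>
        (1 / (1 - lam_sum C K)) *\<^sub>R
          (ubar - (\<Sum>e\<in>cell_edges K. lam C K e *\<^sub>R (\<Sum>\<nu>=1..qn Q. qw Q e \<nu> *\<^sub>R uh (qx Q e \<nu>)))) \<in> G)"

definition quad_points :: "quadrature \<Rightarrow> cell \<Rightarrow> point set" where
  "quad_points Q K = {qx Q e \<nu> | e \<nu>. e \<in> cell_edges K \<and> \<nu> \<in> {1..qn Q}}"

definition interior_points :: "cad \<Rightarrow> cell \<Rightarrow> point set" where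
  "interior_points C K = {intx C K s | s. s < intn C K}"

definition interior_state :: "cad \<Rightarrow> cell \<Rightarrow> real^'m::finite \<Rightarrow> 'm field \<Rightarrow> real^'m" where
  "interior_state C K ubar u =
     (1 / (1 - lam_sum C K)) *\<^sub>R (ubar - (\<Sum>e\<in>cell_edges K. lam C K e *\<^sub>R edge_avg e u))"

definition limiter_theta ::
  "(cell \<Rightarrow> limiter) \<Rightarrow> (real^'m::finite) set \<Rightarrow> quadrature \<Rightarrow> cad \<Rightarrow> cell \<Rightarrow> 'm field \<Rightarrow> real^'m \<Rightarrow> real" where
  "limiter_theta lk G Q C K u ubar = (case lk K of
     Classic \<Rightarrow> Sup {\<theta>\<in>{0..1}. \<forall>x\<in>quad_points Q K \<union> interior_points C K. ubar + \<theta> *\<^sub>R (u x - ubar) \<in> G}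
   | Alternative \<Rightarrow> Sup {\<theta>\<in>{0..1}. (\<forall>x\<in>quad_points Q K. ubar + \<theta> *\<^sub>R (u x - ubar) \<in> G) \<and>
       (lam_sum C K < 1 \<longrightarrow> ubar + \<theta> *\<^sub>R (interior_state C K ubar u - ubar) \<in> G)})"

definition limiter_Pi ::
  "(cell \<Rightarrow> limiter) \<Rightarrow> (real^'m::finite) set \<Rightarrow> quadrature \<Rightarrow> cad \<Rightarrow> cell \<Rightarrow> 'm field \<Rightarrow> real^'m \<Rightarrow> 'm field" where
  "limiter_Pi lk G Q C K u ubar = (\<lambda>x. ubar + limiter_theta lk G Q C K u ubar *\<^sub>R (u x - ubar))"

section \<open>Boundary data\<close>

definition hybrid_dist :: "cell set \<Rightarrow> 'm::finite hybrid \<Rightarrow> 'm hybrid \<Rightarrow> real" where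
  "hybrid_dist \<T> v w = (\<Sum>K\<in>\<T>. norm (fst v K - fst w K)) + (\<Sum>\<sigma>\<in>nodes \<T>. norm (snd v \<sigma> - snd w \<sigma>))"

definition hybrid_domain ::
  "cell set \<Rightarrow> (real^'m::finite) set \<Rightarrow> (real^'m) set \<Rightarrow> 'm hybrid set" where
  "hybrid_domain \<T> G Ufwd = {v. (\<forall>K\<in>\<T>. fst v K \<in> G) \<and> (\<forall>\<sigma>\<in>nodes \<T>. snd v \<sigma> \<in> Ufwd)}"

definition locally_Lipschitz_hybrid ::
  "cell set \<Rightarrow> 'm::finite hybrid set \<Rightarrow> ('m hybrid \<Rightarrow> real^'m) \<Rightarrow> bool" where
  "locally_Lipschitz_hybrid \<T> D b \<longleftrightarrow>
     (\<forall>v\<in>D. \<exists>\<delta>>0. \<exists>L. \<forall>w\<in>D. \<forall>w'\<in>D. hybrid_dist \<T> v w < \<delta> \<and> hybrid_dist \<T> v w' < \<delta> \<longrightarrow>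
        norm (b w - b w') \<le> L * hybrid_dist \<T> w w')"

text \<open>\<open>bst e \<nu>\<close> is the exterior state prescribed at a quadrature node of a boundary edge; it may
  depend on the current hybrid state (as for wall conditions).\<close>

definition boundary_states ::
  "cell set \<Rightarrow> (real^'m::finite) set \<Rightarrow> (real^'m) set \<Rightarrow> quadrature \<Rightarrow>
   (edge \<Rightarrow> nat \<Rightarrow> 'm hybrid \<Rightarrow> real^'m) \<Rightarrow> bool" where
  "boundary_states \<T> G Ufwd Q bst \<longleftrightarrow>
     (\<forall>K\<in>\<T>. \<forall>e\<in>cell_edges K. \<not> has_neighbour \<T> K e \<longrightarrow> (\<forall>\<nu>\<in>{1..qn Q}.
        (\<forall>v\<in>hybrid_domain \<T> G Ufwd. bst e \<nu> v \<in> G) \<and>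
        locally_Lipschitz_hybrid \<T> (hybrid_domain \<T> G Ufwd) (bst e \<nu>)))"

section \<open>Conservative update\<close>

definition exterior_trace ::
  "cell set \<Rightarrow> quadrature \<Rightarrow> (edge \<Rightarrow> nat \<Rightarrow> 'm::finite hybrid \<Rightarrow> real^'m) \<Rightarrow> 'm hybrid \<Rightarrow>
   (cell \<Rightarrow> 'm field) \<Rightarrow> cell \<Rightarrow> edge \<Rightarrow> nat \<Rightarrow> real^'m" where
  "exterior_trace \<T> Q bst v uhat K e \<nu> =
     (if has_neighbour \<T> K e then uhat (neighbour \<T> K e) (qx Q e \<nu>) else bst e \<nu> v)"

definition viscosity_bound ::
  "cell set \<Rightarrow> quadrature \<Rightarrow> (edge \<Rightarrow> nat \<Rightarrow> 'm::finite hybrid \<Rightarrow> real^'m) \<Rightarrow> (real^'m \<Rightarrow> point \<Rightarrow> real) \<Rightarrow>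
   'm hybrid \<Rightarrow> (cell \<Rightarrow> 'm field) \<Rightarrow> (cell \<Rightarrow> edge \<Rightarrow> nat \<Rightarrow> real) \<Rightarrow> bool" where
  "viscosity_bound \<T> Q bst ws v uhat \<alpha> \<longleftrightarrow>
     (\<forall>K\<in>\<T>. \<forall>e\<in>cell_edges K. \<forall>\<nu>\<in>{1..qn Q}.
        max (ws (uhat K (qx Q e \<nu>)) (outward_normal K e))
            (ws (exterior_trace \<T> Q bst v uhat K e \<nu>) (outward_normal K e)) \<le> \<alpha> K e \<nu>)"

definition average_update ::
  "cell set \<Rightarrow> quadrature \<Rightarrow> (2 \<Rightarrow> real^'m::finite \<Rightarrow> real^'m) \<Rightarrow> (edge \<Rightarrow> nat \<Rightarrow> 'm hybrid \<Rightarrow> real^'m) \<Rightarrow>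
   (cell \<Rightarrow> edge \<Rightarrow> nat \<Rightarrow> real) \<Rightarrow> real \<Rightarrow> 'm hybrid \<Rightarrow> (cell \<Rightarrow> 'm field) \<Rightarrow> cell \<Rightarrow> real^'m" where
  "average_update \<T> Q f bst \<alpha> dt v uhat K =
     fst v K - (dt / area K) *\<^sub>R (\<Sum>e\<in>cell_edges K. edge_length e *\<^sub>R (\<Sum>\<nu>=1..qn Q. qw Q e \<nu> *\<^sub>R
       (let um = uhat K (qx Q e \<nu>); up = exterior_trace \<T> Q bst v uhat K e \<nu>; n = outward_normal K e in
         (1/2) *\<^sub>R (normal_flux f um n + normal_flux f up n) - (\<alpha> K e \<nu> / 2) *\<^sub>R (up - um))))"

definition max_wave_speed ::
  "quadrature \<Rightarrow> (real^'m::finite \<Rightarrow> point \<Rightarrow> real) \<Rightarrow> (cell \<Rightarrow> 'm field) \<Rightarrow> cell \<Rightarrow> real" where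
  "max_wave_speed Q ws uhat K =
     (MAX e\<in>cell_edges K. MAX \<nu>\<in>{1..qn Q}. ws (uhat K (qx Q e \<nu>)) (outward_normal K e))"

section \<open>Point update\<close>

definition jacobian :: "(real^'m::finite \<Rightarrow> real^'m) \<Rightarrow> real^'m \<Rightarrow> real^'m^'m" where
  "jacobian F u = matrix (frechet_derivative F (at u))"

definition flux_matrix :: "(2 \<Rightarrow> real^'m::finite \<Rightarrow> real^'m) \<Rightarrow> point \<Rightarrow> real^'m \<Rightarrow> real^'m^'m" where
  "flux_matrix f q u = (\<Sum>i\<in>UNIV. q$i *\<^sub>R jacobian (f i) u)"

definition hyperbolic_on :: "(real^'m::finite) set \<Rightarrow> (2 \<Rightarrow> real^'m \<Rightarrow> real^'m) \<Rightarrow> bool" where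
  "hyperbolic_on D f \<longleftrightarrow> (\<forall>u\<in>D. (\<forall>i. f i differentiable (at u)) \<and>
     (\<forall>n. norm n = 1 \<longrightarrow> (\<exists>(P :: real^'m^'m) d. invertible P \<and>
        flux_matrix f n u = P ** (\<chi> i j. if i = j then d i else 0) ** matrix_inv P)))"

definition transformed_jacobian ::
  "(2 \<Rightarrow> real^'m::finite \<Rightarrow> real^'m) \<Rightarrow> (real^'m \<Rightarrow> real^'m) \<Rightarrow> point \<Rightarrow> real^'m \<Rightarrow> real^'m^'m" where
  "transformed_jacobian f Tm q u = jacobian Tm u ** flux_matrix f q u ** matrix_inv (jacobian Tm u)"

definition spectral_radius :: "real^'m::finite^'m \<Rightarrow> real" where
  "spectral_radius M = Sup {cmod z | z. \<exists>x. x \<noteq> 0 \<and> map_matrix complex_of_real M *v x = z *s x}"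

definition edges_at :: "cell set \<Rightarrow> point \<Rightarrow> edge set" where
  "edges_at \<T> \<sigma> = {e \<in> mesh_edges \<T>. \<sigma> \<in> e}"

text \<open>The four places in the point operator where a one-sided derivative can be missing.\<close>

datatype slot = Normal_minus | Normal_plus | Tangent_minus | Tangent_ext

record 'm point_data =
  tang :: "point \<Rightarrow> edge \<Rightarrow> point"
  tie :: "point \<Rightarrow> edge \<Rightarrow> cell set \<Rightarrow> cell"
  asig :: "point \<Rightarrow> real"
  bder :: "slot \<Rightarrow> point \<Rightarrow> edge \<Rightarrow> 'm hybrid \<Rightarrow> real^'m"

text \<open>With \<open>\<tau> = tang P \<sigma> e\<close>, the pair \<open>(rnormal \<tau>, \<tau>)\<close> is a right-handed orthonormal basis.\<close>

definition rnormal :: "point \<Rightarrow> point" where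
  "rnormal \<tau> = vector [\<tau>$2, - \<tau>$1]"

definition minus_cells :: "cell set \<Rightarrow> ('m::finite) point_data \<Rightarrow> point \<Rightarrow> edge \<Rightarrow> cell set" where
  "minus_cells \<T> P \<sigma> e = {K\<in>\<T>. e \<in> cell_edges K \<and> outward_normal K e = rnormal (tang P \<sigma> e)}"

definition plus_cells :: "cell set \<Rightarrow> ('m::finite) point_data \<Rightarrow> point \<Rightarrow> edge \<Rightarrow> cell set" where
  "plus_cells \<T> P \<sigma> e = {K\<in>\<T>. e \<in> cell_edges K \<and> outward_normal K e = - rnormal (tang P \<sigma> e)}"

text \<open>Closed cells are used here: if the backward ray runs inside an open cell this is the only
  candidate, and if it runs along an edge the cells on both sides are candidates and \<open>tie\<close> decides.\<close>

definition ext_cells :: "cell set \<Rightarrow> ('m::finite) point_data \<Rightarrow> point \<Rightarrow> edge \<Rightarrow> cell set" where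
  "ext_cells \<T> P \<sigma> e = {K\<in>\<T>. \<exists>\<epsilon>0>0. \<forall>\<epsilon>. 0 < \<epsilon> \<and> \<epsilon> < \<epsilon>0 \<longrightarrow> \<sigma> - \<epsilon> *\<^sub>R tang P \<sigma> e \<in> closure K}"

text \<open>Derivative of the transformed reconstruction taken from the selected candidate cell, or supplied by
  the boundary condition if there is no such cell.\<close>

definition transformed_deriv ::
  "(real^'m::finite \<Rightarrow> real^'m) \<Rightarrow> (cell \<Rightarrow> 'm hybrid \<Rightarrow> 'm field) \<Rightarrow> 'm point_data \<Rightarrow> 'm hybrid \<Rightarrow>
   slot \<Rightarrow> point \<Rightarrow> edge \<Rightarrow> cell set \<Rightarrow> point \<Rightarrow> real^'m" where
  "transformed_deriv Tm \<R> P v sl \<sigma> e S q =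
     (if S = {} then bder P sl \<sigma> e v
      else jacobian Tm (snd v \<sigma>) *v frechet_derivative (\<R> (tie P \<sigma> e S) v) (at \<sigma>) q)"

definition interior_angle :: "('m::finite) point_data \<Rightarrow> cell \<Rightarrow> point \<Rightarrow> real" where
  "interior_angle P K \<sigma> = (THE a. \<exists>e1 e2. e1 \<noteq> e2 \<and> {e \<in> cell_edges K. \<sigma> \<in> e} = {e1, e2} \<and>
      a = arccos (tang P \<sigma> e1 \<bullet> tang P \<sigma> e2))"

definition edge_angle :: "cell set \<Rightarrow> ('m::finite) point_data \<Rightarrow> point \<Rightarrow> edge \<Rightarrow> real" where
  "edge_angle \<T> P \<sigma> e = (1/2) * (\<Sum>K\<in>{K\<in>\<T>. e \<in> cell_edges K}. interior_angle P K \<sigma>)"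

definition edge_weight :: "cell set \<Rightarrow> ('m::finite) point_data \<Rightarrow> point \<Rightarrow> edge \<Rightarrow> real" where
  "edge_weight \<T> P \<sigma> e = edge_angle \<T> P \<sigma> e / (\<Sum>e'\<in>edges_at \<T> \<sigma>. edge_angle \<T> P \<sigma> e')"

text \<open>At a vertex the tangent is determined by its edge; at a midpoint it is one of the two unit
  tangents of the edge.\<close>

definition point_geometry :: "cell set \<Rightarrow> ('m::finite) point_data \<Rightarrow> bool" where
  "point_geometry \<T> P \<longleftrightarrow> (\<forall>\<sigma>\<in>nodes \<T>. \<forall>e\<in>edges_at \<T> \<sigma>.
     norm (tang P \<sigma> e) = 1 \<and> (\<exists>\<epsilon>>0. \<sigma> + \<epsilon> *\<^sub>R tang P \<sigma> e \<in> e) \<and>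
     (\<forall>S\<subseteq>\<T>. S \<noteq> {} \<longrightarrow> tie P \<sigma> e S \<in> S))"

definition point_speeds ::
  "cell set \<Rightarrow> (2 \<Rightarrow> real^'m::finite \<Rightarrow> real^'m) \<Rightarrow> (real^'m \<Rightarrow> real^'m) \<Rightarrow> 'm point_data \<Rightarrow> 'm hybrid \<Rightarrow> bool" where
  "point_speeds \<T> f Tm P v \<longleftrightarrow> (\<forall>\<sigma>\<in>nodes \<T>. 0 < asig P \<sigma> \<and> (\<forall>e\<in>edges_at \<T> \<sigma>.
     spectral_radius (transformed_jacobian f Tm (rnormal (tang P \<sigma> e)) (snd v \<sigma>)) \<le> asig P \<sigma> \<and>
     spectral_radius (transformed_jacobian f Tm (tang P \<sigma> e) (snd v \<sigma>)) \<le> asig P \<sigma>))"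

definition boundary_derivatives ::
  "cell set \<Rightarrow> (real^'m::finite) set \<Rightarrow> (real^'m) set \<Rightarrow> 'm point_data \<Rightarrow> bool" where
  "boundary_derivatives \<T> G Ufwd P \<longleftrightarrow> (\<forall>sl. \<forall>\<sigma>\<in>nodes \<T>. \<forall>e\<in>edges_at \<T> \<sigma>.
     locally_Lipschitz_hybrid \<T> (hybrid_domain \<T> G Ufwd) (bder P sl \<sigma> e))"

definition point_operator ::
  "cell set \<Rightarrow> (2 \<Rightarrow> real^'m::finite \<Rightarrow> real^'m) \<Rightarrow> (real^'m \<Rightarrow> real^'m) \<Rightarrow>
   (cell \<Rightarrow> 'm hybrid \<Rightarrow> 'm field) \<Rightarrow> 'm point_data \<Rightarrow> 'm hybrid \<Rightarrow> point \<Rightarrow> real^'m" where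
  "point_operator \<T> f Tm \<R> P v \<sigma> =
    (let J = (\<lambda>q. transformed_jacobian f Tm q (snd v \<sigma>));
         Jp = (\<lambda>q. (1/2) *\<^sub>R (J q + asig P \<sigma> *\<^sub>R mat 1));
         Jm = (\<lambda>q. (1/2) *\<^sub>R (J q - asig P \<sigma> *\<^sub>R mat 1));
         t = tang P \<sigma>;
         n = (\<lambda>e. rnormal (tang P \<sigma> e));
         dw = (\<lambda>sl e S q. transformed_deriv Tm \<R> P v sl \<sigma> e S q)
     in if \<sigma> \<in> mesh_vertices \<T> then
          - (\<Sum>e\<in>edges_at \<T> \<sigma>. edge_weight \<T> P \<sigma> e *\<^sub>R
              (Jp (n e) *v dw Normal_minus e (minus_cells \<T> P \<sigma> e) (n e)
             + Jm (n e) *v dw Normal_plus e (plus_cells \<T> P \<sigma> e) (n e)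
             + Jm (t e) *v dw Tangent_minus e (minus_cells \<T> P \<sigma> e) (t e)
             + Jp (t e) *v dw Tangent_ext e (ext_cells \<T> P \<sigma> e) (t e)))
        else
          (let e = (THE e. e \<in> edges_at \<T> \<sigma>) in
          - (Jp (n e) *v dw Normal_minus e (minus_cells \<T> P \<sigma> e) (n e)
             + Jm (n e) *v dw Normal_plus e (plus_cells \<T> P \<sigma> e) (n e)
             + J (t e) *v dw Tangent_minus e (minus_cells \<T> P \<sigma> e) (t e))))"

definition forward_map :: "(real^'m::finite) set \<Rightarrow> (real^'m \<Rightarrow> real^'m) \<Rightarrow> bool" where
  "forward_map Ufwd Tm \<longleftrightarrow> (\<forall>u\<in>Ufwd. Tm differentiable (at u) \<and> invertible (jacobian Tm u))"

definition admissible_inverse ::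
  "(real^'m::finite \<Rightarrow> real^'m) \<Rightarrow> (real^'m \<Rightarrow> real^'m) \<Rightarrow> (real^'m) set \<Rightarrow> bool" where
  "admissible_inverse Tm B Gpt \<longleftrightarrow> range B = Gpt \<and> convex Gpt \<and> (\<forall>u\<in>Gpt. B (Tm u) = u)"

end

theory Submission
  imports Defs
begin

text \<open>The point values stay admissible because they are images under the inverse map \<open>B\<close>, whose range
  is the set of admissible point states. The content is in the cell averages.

  The invariant domain \<open>G\<close> is an intersection of half-spaces, one for each constraint \<open>j\<close> and contact point \<open>us\<close>, with inner
  normal \<open>grad (g j) us\<close>. It therefore suffices to follow the linear functional
  \<open>\<lambda>v. (v - us) \<bullet> grad (g j) us\<close> through the update. It is nonnegative on \<open>G\<close>, and the cell average
  decomposition bounds its value at the old average below by a positive combination of its values at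
  the limited interior traces (\<open>cell_average_above_edge_average\<close>). The weak Lax--Friedrichs splitting bounds the
  normal component of each numerical flux above by \<open>\<alpha>\<close> times the value at the interior trace, minus
  \<open>\<zeta> j us \<bullet> n\<close> (\<open>weak_LF_flux_bound\<close>). After multiplication by \<open>dt\<close>, the first part is absorbed by the
  combination of interior traces, since \<open>dt * \<alpha>\<close> is at most \<open>cad_mu C K\<close>. The second part is not small and
  has no sign, but \<open>\<zeta> j us\<close> is constant along the boundary of the cell, so it disappears in the sum over
  all edges, because the outward normals of a closed polygon, scaled by the edge lengths, add up to
  zero (\<open>polygon_closed\<close>).

  That last identity is the divergence theorem for a constant field. For a convex polygon it follows from
  an elementary formula (\<open>polygon_area\<close>): the area is the sum of the areas of the triangles that join
  the edges to an interior point \<open>p\<close>. The formula is affine in \<open>p\<close> and yet independent of \<open>p\<close>, so its linear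
  part, which is the sum of scaled normals, vanishes.\<close>

section \<open>Triangles and rays\<close>

lemma diameter_closed_segment:
  fixes a b :: "'a::euclidean_space"
  shows "diameter (closed_segment a b) = dist a b"
proof (rule antisym)
  show "diameter (closed_segment a b) \<le> dist a b"
  proof (rule diameter_le)
    fix x y assume xy: "x \<in> closed_segment a b" "y \<in> closed_segment a b"
    obtain s where s: "0 \<le> s" "s \<le> 1" "x = (1 - s) *\<^sub>R a + s *\<^sub>R b" using xy(1) by (auto simp: in_segment)
    obtain t where t: "0 \<le> t" "t \<le> 1" "y = (1 - t) *\<^sub>R a + t *\<^sub>R b" using xy(2) by (auto simp: in_segment)
    have "x - y = (t - s) *\<^sub>R (a - b)" unfolding s t by (simp add: algebra_simps)
    then have "norm (x - y) = \<bar>t - s\<bar> * dist a b" by (simp add: dist_norm)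
    also have "\<dots> \<le> 1 * dist a b" using s t by (intro mult_right_mono) auto
    finally show "norm (x - y) \<le> dist a b" by simp
  qed simp
  show "dist a b \<le> diameter (closed_segment a b)"
    by (rule diameter_bounded_bound) (auto simp: bounded_closed_segment)
qed

text \<open>A convex set is star-shaped about an interior point \<open>p\<close>, and even more: every point strictly
  between \<open>p\<close> and a point of the set is interior. So a ray from \<open>p\<close> cannot meet the boundary twice.\<close>

lemma radial_boundary_point_unique:
  fixes S :: "'a::euclidean_space set"
  assumes S: "convex S" "closed S" and p: "p \<in> interior S"
    and a: "a \<in> S - interior S" and b: "b \<in> S - interior S"
    and x: "x \<in> closed_segment p a" "x \<in> closed_segment p b" "x \<noteq> p"
  shows "a = b"
proof -
  have not_between: False
    if c: "c \<in> S - interior S" and d: "d \<in> S - interior S"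
      and sc: "x = p + s *\<^sub>R (c - p)" and td: "x = p + t *\<^sub>R (d - p)" and st: "0 < s" "s < t" for c d s t
  proof -
    have "t *\<^sub>R (d - p) = s *\<^sub>R (c - p)" using sc td by simp
    then have "d - p = (s / t) *\<^sub>R (c - p)"
      using st by (simp add: eq_vector_fraction_iff)
    then have "d = (1 - s/t) *\<^sub>R p + (s/t) *\<^sub>R c"
      by (simp add: algebra_simps)
    moreover have "p \<noteq> c" using p c by auto
    ultimately have "d \<in> open_segment p c"
      using st unfolding in_segment by (intro conjI exI[of _ "s/t"]) auto
    moreover have "open_segment p c \<subseteq> interior S"
      using in_interior_closure_convex_segment[OF S(1) p] c closure_closed[OF S(2)] by auto
    ultimately show False using d by auto
  qed
  obtain s where s: "0 \<le> s" "x = p + s *\<^sub>R (a - p)"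
    using x(1) by (auto simp: in_segment algebra_simps)
  obtain t where t: "0 \<le> t" "x = p + t *\<^sub>R (b - p)"
    using x(2) by (auto simp: in_segment algebra_simps)
  have "s \<noteq> 0" "t \<noteq> 0" using s t x(3) by auto
  then have "s = t"
    using not_between[OF a b s(2) t(2)] not_between[OF b a t(2) s(2)] s(1) t(1)
    by (metis less_eq_real_def linorder_neqE_linordered_idom)
  then show ?thesis using s t \<open>s \<noteq> 0\<close> by auto
qed

text \<open>The orthogonal complement of a unit vector \<open>n\<close> of the plane is spanned by \<open>n\<close> turned by a right
  angle, so \<open>v\<close> is determined by the determinant of the pair \<open>(n, v)\<close>.\<close>

lemma plane_orthogonal_to_unit:
  fixes n v :: "real^2"
  assumes "norm n = 1" "v \<bullet> n = 0"
  shows "v$1 = - (v$2 * n$1 - v$1 * n$2) * n$2" "v$2 = (v$2 * n$1 - v$1 * n$2) * n$1"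
    "norm v = \<bar>v$2 * n$1 - v$1 * n$2\<bar>"
proof -
  have n: "n$1 * n$1 + n$2 * n$2 = 1"
    using assms(1) by (simp add: norm_eq_1 inner_vec_def sum_2)
  have v: "v$1 * n$1 + v$2 * n$2 = 0"
    using assms(2) by (simp add: inner_vec_def sum_2)
  have "v$1 = v$1 * (n$1 * n$1 + n$2 * n$2) - n$1 * (v$1 * n$1 + v$2 * n$2)"
    unfolding n v by simp
  then show 1: "v$1 = - (v$2 * n$1 - v$1 * n$2) * n$2" by (simp add: algebra_simps)
  have "v$2 = v$2 * (n$1 * n$1 + n$2 * n$2) - n$2 * (v$1 * n$1 + v$2 * n$2)"
    unfolding n v by simp
  then show 2: "v$2 = (v$2 * n$1 - v$1 * n$2) * n$1" by (simp add: algebra_simps)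
  define s where "s = v$2 * n$1 - v$1 * n$2"
  have "(norm v)\<^sup>2 = (v$1)\<^sup>2 + (v$2)\<^sup>2"
    unfolding power2_norm_eq_inner by (simp add: inner_vec_def sum_2 power2_eq_square)
  also have "\<dots> = (- s * n$2)\<^sup>2 + (s * n$1)\<^sup>2"
    unfolding s_def using 1 2 by (simp only:)
  also have "\<dots> = s\<^sup>2 * (n$1 * n$1 + n$2 * n$2)" by (simp add: power2_eq_square algebra_simps)
  finally have "(norm v)\<^sup>2 = s\<^sup>2" by (simp add: n)
  then show "norm v = \<bar>v$2 * n$1 - v$1 * n$2\<bar>"
    unfolding s_def[symmetric] by (simp add: power2_eq_iff abs_if) (smt (verit) norm_ge_zero)
qed

lemma triangle_area_base_height:
  fixes p a b n :: "real^2"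
  assumes n: "norm n = 1" "(b - a) \<bullet> n = 0"
  shows "measure lebesgue (convex hull {p, a, b}) = dist a b * \<bar>(a - p) \<bullet> n\<bar> / 2"
proof -
  let ?v = "b - a"
  define s where "s = ?v$2 * n$1 - ?v$1 * n$2"
  have v: "b$1 - a$1 = - s * n$2" "b$2 - a$2 = s * n$1" "dist a b = \<bar>s\<bar>"
    using plane_orthogonal_to_unit[OF n] by (simp_all add: s_def dist_norm norm_minus_commute)
  have "measure lebesgue (convex hull {p, a, b}) = measure lborel (convex hull {p, a, b})"
    by (rule measure_completion) (auto intro!: borel_compact finite_imp_compact_convex_hull)
  also have "\<dots> = \<bar>(b$1 - p$1) * (a$2 - p$2) - (a$1 - p$1) * (b$2 - p$2)\<bar> / 2"
    by (rule content_triangle)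
  also have "(b$1 - p$1) * (a$2 - p$2) - (a$1 - p$1) * (b$2 - p$2)
      = (b$1 - a$1) * (a$2 - p$2) - (a$1 - p$1) * (b$2 - a$2)" by algebra
  also have "\<dots> = - (s * ((a - p) \<bullet> n))"
    unfolding v(1,2) by (simp add: inner_vec_def sum_2 algebra_simps)
  finally show ?thesis by (simp add: v(3) abs_mult)
qed

section \<open>Convex polygonal cells\<close>

lemma
  assumes "open_convex_polygon K"
  shows polygon_interior: "interior (closure K) = K"
    and polygon_bounded: "bounded K"
    and polygon_measurable: "K \<in> lmeasurable"
    and polygon_area_closure: "measure lebesgue (closure K) = area K"
    and polygon_aff_dim: "aff_dim (closure K) = 2"
    and polygon_polyhedron: "polyhedron (closure K)"
    and finite_cell_edges: "finite (cell_edges K)"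
proof -
  have K: "open K" "convex K" "K \<noteq> {}" "polytope (closure K)"
    using assms by (auto simp: open_convex_polygon_def)
  show i: "interior (closure K) = K"
    using K by (simp add: convex_interior_closure interior_open)
  show b: "bounded K" using K polytope_imp_bounded bounded_subset closure_subset by blast
  show "K \<in> lmeasurable" using K b by (simp add: lmeasurable_open)
  show "measure lebesgue (closure K) = area K"
    unfolding area_def using K b
    by (metis i measure_interior bounded_closure convex_closure negligible_convex_frontier)
  show "aff_dim (closure K) = 2"
    using aff_dim_nonempty_interior[of "closure K"] i K by auto
  show "polyhedron (closure K)" using K polytope_imp_polyhedron by blast
  have "finite {T. T face_of closure K}" by (rule finite_polytope_faces[OF K(4)])
  then show "finite (cell_edges K)"
    by (rule rev_finite_subset) (auto simp: cell_edges_def edge_of_def)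
qed

text \<open>Cells are two-dimensional, so that the theory of facets of polyhedra applies to edges:
  facets cover the boundary, and each one is cut out by a supporting hyperplane.\<close>

lemma cell_edge_iff_facet:
  assumes "open_convex_polygon K"
  shows "e \<in> cell_edges K \<longleftrightarrow> e facet_of closure K"
  using polygon_aff_dim[OF assms] by (auto simp: cell_edges_def edge_of_def facet_of_def)

lemma polygon_frontier:
  assumes "open_convex_polygon K"
  shows "closure K - K = \<Union>(cell_edges K)"
proof -
  have "rel_frontier (closure K) = \<Union>{F. F facet_of closure K}"
    by (rule rel_frontier_of_polyhedron[OF polygon_polyhedron[OF assms]])
  also have "{F. F facet_of closure K} = cell_edges K"
    using cell_edge_iff_facet[OF assms] by auto
  also have "rel_frontier (closure K) = closure K - K"
    using assms polygon_interior[OF assms]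
    by (auto simp: rel_frontier_def open_convex_polygon_def rel_interior_nonempty_interior)
  finally show ?thesis .
qed

lemma cell_edge_segment:
  assumes "open_convex_polygon K" "e \<in> cell_edges K"
  obtains a b where "a \<noteq> b" "e = closed_segment a b"
proof -
  have e: "e face_of closure K" "aff_dim e = 1" and K: "polytope (closure K)"
    using assms by (auto simp: cell_edges_def edge_of_def open_convex_polygon_def)
  have "polytope e" using face_of_polytope_polytope K e by blast
  moreover have "e \<noteq> {}" using e(2) by auto
  ultimately obtain a b where ab: "e = closed_segment a b"
    using compact_convex_collinear_segment[of e] e(2)
    by (metis collinear_aff_dim polytope_imp_compact polytope_imp_convex order_refl)
  have "a \<noteq> b" using e(2) ab by auto
  then show thesis using ab that by blast
qed

text \<open>The description defining the outward normal has a solution, the normalised supporting functional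
  of the facet. It has only one: by continuity a solution is orthogonal to the edge, which leaves two
  opposite unit vectors in the plane, and they cannot both point away from the same point of the cell.\<close>

lemma
  assumes K: "open_convex_polygon K" and e: "e \<in> cell_edges K"
  shows norm_outward_normal: "norm (outward_normal K e) = 1"
    and outward_normal_strict: "\<And>x y. x \<in> e \<Longrightarrow> y \<in> K \<Longrightarrow> (y - x) \<bullet> outward_normal K e < 0"
    and outward_normal_orthogonal: "\<And>x x'. x \<in> e \<Longrightarrow> x' \<in> e \<Longrightarrow> (x' - x) \<bullet> outward_normal K e = 0"
proof -
  let ?P = "\<lambda>n. norm n = 1 \<and> (\<forall>x\<in>e. \<forall>y\<in>K. (y - x) \<bullet> n < 0)"
  obtain a b where ab: "a \<noteq> b" "e = closed_segment a b"
    using cell_edge_segment[OF K e] .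
  have openK: "open K" and neK: "K \<noteq> {}" using K by (auto simp: open_convex_polygon_def)
  have sub: "e \<subseteq> closure K" using polygon_frontier[OF K] e by auto
  obtain d c where d: "d \<noteq> 0" "closure K \<subseteq> {x. d \<bullet> x \<le> c}" "e = closure K \<inter> {x. d \<bullet> x = c}"
    using facet_of_polyhedron[OF polygon_polyhedron[OF K]] e cell_edge_iff_facet[OF K] by metis
  have "K \<subseteq> interior {x. d \<bullet> x \<le> c}"
    using d(2) closure_subset[of K] openK by (intro interior_maximal) auto
  then have less: "d \<bullet> y < c" if "y \<in> K" for y
    using that d(1) by (auto simp: interior_halfspace_le)
  have ex: "?P (d /\<^sub>R norm d)"
    using d(1,3) less by (auto simp: inner_diff_right inner_commute[of _ d] divide_simps)
  have tangent: "(x' - x) \<bullet> n = 0" if n: "?P n" and x: "x \<in> e" "x' \<in> e" for n x x'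
  proof -
    have le: "(y - z) \<bullet> n \<le> 0" if "z \<in> e" "y \<in> e" for y z
    proof -
      have "closure K \<subseteq> {y. n \<bullet> y \<le> n \<bullet> z}"
      proof (rule closure_minimal)
        show "K \<subseteq> {y. n \<bullet> y \<le> n \<bullet> z}"
          using n that(1) by (auto simp: inner_diff_left inner_commute[of n] intro: less_imp_le)
      qed (rule closed_halfspace_le)
      then show ?thesis using that sub by (auto simp: inner_diff_left inner_commute[of n])
    qed
    show ?thesis using le[OF x] le[OF x(2,1)] by (simp add: inner_diff_left)
  qed
  have unique: "m = n" if n: "?P n" and m: "?P m" for n m
  proof -
    have "a \<in> e" "b \<in> e" using ab by auto
    then have vn: "(b - a) \<bullet> n = 0" and vm: "(b - a) \<bullet> m = 0" using tangent n m by auto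
    define s where "s = (b-a)$2 * n$1 - (b-a)$1 * n$2"
    have v: "(b-a)$1 = - s * n$2" "(b-a)$2 = s * n$1" "norm (b - a) = \<bar>s\<bar>"
      using plane_orthogonal_to_unit[OF _ vn] n by (simp_all add: s_def)
    have "s \<noteq> 0" using v(3) ab(1) by auto
    have "s * (n$1 * m$2 - n$2 * m$1) = 0"
      using vm unfolding inner_vec_def sum_2 inner_real_def v(1,2) by (simp add: algebra_simps)
    then have par: "n$1 * m$2 = n$2 * m$1" using \<open>s \<noteq> 0\<close> by simp
    have n1: "n$1 * n$1 + n$2 * n$2 = 1"
      using n by (simp add: norm_eq_1 inner_vec_def sum_2)
    have "m$1 = (m \<bullet> n) * n$1" "m$2 = (m \<bullet> n) * n$2"
    proof -
      have "(m \<bullet> n) * n$1 = m$1 * (n$1 * n$1 + n$2 * n$2) + n$2 * (n$1 * m$2 - n$2 * m$1)"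
        "(m \<bullet> n) * n$2 = m$2 * (n$1 * n$1 + n$2 * n$2) - n$1 * (n$1 * m$2 - n$2 * m$1)"
        by (simp_all add: inner_vec_def sum_2 algebra_simps)
      then show "m$1 = (m \<bullet> n) * n$1" "m$2 = (m \<bullet> n) * n$2" by (simp_all add: n1 par)
    qed
    then have mn: "m = (m \<bullet> n) *\<^sub>R n" by (simp add: vec_eq_iff forall_2)
    obtain y where y: "y \<in> K" using neK by auto
    have "(y - a) \<bullet> n < 0" "(y - a) \<bullet> m < 0" using n m y \<open>a \<in> e\<close> by auto
    moreover have "(y - a) \<bullet> m = (m \<bullet> n) * ((y - a) \<bullet> n)" by (metis mn inner_scaleR_right)
    ultimately have "0 < m \<bullet> n" by (simp add: mult_less_0_iff)
    moreover have "\<bar>m \<bullet> n\<bar> = 1" using arg_cong[OF mn, of norm] n m by simp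
    ultimately show "m = n" using mn by simp
  qed
  have P: "?P (outward_normal K e)"
    unfolding outward_normal_def by (rule theI[where P="?P", OF ex]) (rule unique[OF ex])
  show "norm (outward_normal K e) = 1" using P by blast
  show "\<And>x y. x \<in> e \<Longrightarrow> y \<in> K \<Longrightarrow> (y - x) \<bullet> outward_normal K e < 0" using P by blast
  show "\<And>x x'. x \<in> e \<Longrightarrow> x' \<in> e \<Longrightarrow> (x' - x) \<bullet> outward_normal K e = 0"
    by (rule tangent[OF P])
qed

section \<open>Area of a cell and the sum of its normals\<close>

text \<open>The ray from \<open>p\<close> through a point of the closed cell leaves the cell not before that point,
  and does so through an edge. At the point \<open>p\<close> itself any direction will do.\<close>

lemma polygon_cone_decomposition:
  assumes K: "open_convex_polygon K" and p: "p \<in> K"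
  shows "closure K = (\<Union>e\<in>cell_edges K. convex hull (insert p e))"
proof
  have conv: "convex (closure K)" using K by (simp add: open_convex_polygon_def)
  have pc: "p \<in> closure K" using p closure_subset by auto
  show "(\<Union>e\<in>cell_edges K. convex hull (insert p e)) \<subseteq> closure K"
  proof (rule UN_least)
    fix e assume "e \<in> cell_edges K"
    then have "insert p e \<subseteq> closure K" using polygon_frontier[OF K] pc by blast
    then show "convex hull (insert p e) \<subseteq> closure K" by (rule hull_minimal) (rule conv)
  qed
  show "closure K \<subseteq> (\<Union>e\<in>cell_edges K. convex hull (insert p e))"
  proof
    fix x assume x: "x \<in> closure K"
    define l where "l = (if x = p then axis 1 1 else x - p)"
    have "l \<noteq> 0" by (auto simp: l_def axis_eq_0_iff)
    moreover have pin: "p \<in> interior (closure K)" using p polygon_interior[OF K] by simp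
    moreover have "bounded (closure K)" using polygon_bounded[OF K] by (rule bounded_closure)
    ultimately obtain d where d: "0 < d" "p + d *\<^sub>R l \<in> frontier (closure K)"
      using ray_to_frontier by metis
    then have fr: "p + d *\<^sub>R l \<in> closure K - K" using polygon_interior[OF K] by (simp add: frontier_def)
    then obtain e where e: "e \<in> cell_edges K" "p + d *\<^sub>R l \<in> e"
      using polygon_frontier[OF K] by auto
    have "x \<in> closed_segment p (p + d *\<^sub>R l)"
    proof (cases "x = p")
      case False
      then have l: "l = x - p" by (simp add: l_def)
      have "1 \<le> d"
      proof (rule ccontr)
        assume "\<not> 1 \<le> d"
        then have "p + d *\<^sub>R l \<in> open_segment p x"
          using d(1) False unfolding in_segment l by (intro conjI exI[of _ d]) (auto simp: algebra_simps)
        then have "p + d *\<^sub>R l \<in> interior (closure K)"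
          using in_interior_closure_convex_segment[OF conv pin, of x] x by auto
        then show False using fr polygon_interior[OF K] by simp
      qed
      then show ?thesis
        unfolding in_segment l by (intro exI[of _ "1/d"]) (auto simp: algebra_simps)
    qed auto
    also have "closed_segment p (p + d *\<^sub>R l) \<subseteq> convex hull (insert p e)"
      unfolding segment_convex_hull by (rule hull_mono) (use e in auto)
    finally show "x \<in> (\<Union>e\<in>cell_edges K. convex hull (insert p e))" using e(1) by blast
  qed
qed

text \<open>By uniqueness of the boundary point on a ray, two triangles with apex \<open>p\<close> overlap in the cone over
  the intersection of their bases. Two distinct edges meet in a face of dimension at most zero, so this
  cone lies on a line.\<close>

lemma polygon_cones_overlap_negligible:
  assumes K: "open_convex_polygon K" and p: "p \<in> K"
    and e: "e \<in> cell_edges K" and e': "e' \<in> cell_edges K" and ne: "e \<noteq> e'"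
  shows "negligible (convex hull (insert p e) \<inter> convex hull (insert p e'))"
proof -
  have conv: "convex (closure K)" using K by (simp add: open_convex_polygon_def)
  have faces: "e face_of closure K" "e' face_of closure K" and dims: "aff_dim e = 1" "aff_dim e' = 1"
    using e e' by (auto simp: cell_edges_def edge_of_def)
  have cvx: "convex e" "convex e'" using faces face_of_imp_convex by auto
  have nonempty: "e \<noteq> {}" "e' \<noteq> {}" using dims by auto
  have pin: "p \<in> interior (closure K)" using p polygon_interior[OF K] by simp
  have int: "(e \<inter> e') face_of closure K" using faces by (rule face_of_Int)
  have "aff_dim (e \<inter> e') < 1"
  proof (rule ccontr)
    assume "\<not> ?thesis"
    then have "e \<inter> e' = e" "e \<inter> e' = e'"
      using face_of_aff_dim_lt[OF cvx(1), of "e \<inter> e'"] face_of_aff_dim_lt[OF cvx(2), of "e \<inter> e'"] int faces dims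
      by (auto simp: face_of_face)
    then show False using ne by simp
  qed
  then have "aff_dim (convex hull (insert p (e \<inter> e'))) < 2"
    by (simp add: aff_dim_convex_hull aff_dim_insert)
  then have "interior (convex hull (insert p (e \<inter> e'))) = {}"
    using aff_dim_nonempty_interior[of "convex hull (insert p (e \<inter> e'))"] by auto
  then have "negligible (convex hull (insert p (e \<inter> e')))"
    by (simp add: negligible_convex_interior)
  moreover have "convex hull (insert p e) \<inter> convex hull (insert p e') \<subseteq> convex hull (insert p (e \<inter> e'))"
  proof
    fix x assume "x \<in> convex hull (insert p e) \<inter> convex hull (insert p e')"
    then obtain a b where a: "a \<in> e" "x \<in> closed_segment p a" and b: "b \<in> e'" "x \<in> closed_segment p b"
      using nonempty by (auto simp: convex_hull_insert_segments convex_hull_eq[THEN iffD2, OF cvx(1)]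
          convex_hull_eq[THEN iffD2, OF cvx(2)])
    show "x \<in> convex hull (insert p (e \<inter> e'))"
    proof (cases "x = p")
      case True then show ?thesis by (simp add: hull_inc)
    next
      case False
      have "a = b"
        using radial_boundary_point_unique[OF conv _ pin, of a b x] a b False e e'
          polygon_frontier[OF K] polygon_interior[OF K] by auto
      then have "closed_segment p a \<subseteq> convex hull (insert p (e \<inter> e'))"
        unfolding segment_convex_hull using a b by (intro hull_mono) auto
      then show ?thesis using a by auto
    qed
  qed
  ultimately show ?thesis using negligible_subset by blast
qed

text \<open>The cell is the union of the triangles with apex \<open>p\<close> over its edges; the height of such a triangle
  is the component of \<open>x e - p\<close> along the outward normal, for any point \<open>x e\<close> of the edge.\<close>

lemma polygon_area:
  assumes K: "open_convex_polygon K" and p: "p \<in> K" and x: "\<And>e. e \<in> cell_edges K \<Longrightarrow> x e \<in> e"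
  shows "area K = (\<Sum>e\<in>cell_edges K. edge_length e * ((x e - p) \<bullet> outward_normal K e)) / 2"
proof -
  have cone: "convex hull (insert p e) \<in> lmeasurable"
    "measure lebesgue (convex hull (insert p e)) = edge_length e * ((x e - p) \<bullet> outward_normal K e) / 2"
    if e: "e \<in> cell_edges K" for e
  proof -
    obtain a b where ab: "a \<noteq> b" "e = closed_segment a b"
      using cell_edge_segment[OF K e] .
    have "convex hull (insert p e) = convex hull {p, a, b}"
      unfolding ab segment_convex_hull by (metis hull_insert)
    moreover have "compact (convex hull {p, a, b})" by (simp add: finite_imp_compact_convex_hull)
    moreover have "dist a b * \<bar>(a - p) \<bullet> outward_normal K e\<bar> = edge_length e * ((x e - p) \<bullet> outward_normal K e)"
    proof -
      have "a \<in> e" using ab by simp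
      then have "(p - a) \<bullet> outward_normal K e < 0" "(x e - a) \<bullet> outward_normal K e = 0"
        using outward_normal_strict[OF K e] outward_normal_orthogonal[OF K e] p x[OF e] by auto
      then show ?thesis
        by (simp add: edge_length_def ab(2) diameter_closed_segment inner_diff_left)
    qed
    moreover have "(b - a) \<bullet> outward_normal K e = 0"
      using outward_normal_orthogonal[OF K e] ab by simp
    ultimately show "convex hull (insert p e) \<in> lmeasurable"
      "measure lebesgue (convex hull (insert p e)) = edge_length e * ((x e - p) \<bullet> outward_normal K e) / 2"
      using triangle_area_base_height[OF norm_outward_normal[OF K e], of b a p] lmeasurable_compact
      by auto
  qed
  have "area K = measure lebesgue (\<Union>e\<in>cell_edges K. convex hull (insert p e))"
    using polygon_area_closure[OF K] polygon_cone_decomposition[OF K p] by simp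
  also have "\<dots> = (\<Sum>e\<in>cell_edges K. measure lebesgue (convex hull (insert p e)))"
    using finite_cell_edges[OF K] cone(1) polygon_cones_overlap_negligible[OF K p]
    by (intro measure_negligible_finite_Union_image) (auto simp: pairwise_def)
  also have "\<dots> = (\<Sum>e\<in>cell_edges K. edge_length e * ((x e - p) \<bullet> outward_normal K e)) / 2"
    by (simp add: cone(2) sum_divide_distrib)
  finally show ?thesis .
qed

text \<open>The area formula holds for every \<open>p\<close> in the cell while its left-hand side does not
  depend on \<open>p\<close>. Its right-hand side is affine in \<open>p\<close> with slope a multiple of the sum below, so moving
  \<open>p\<close> a little in the direction of that sum shows that its square vanishes.\<close>

lemma polygon_closed:
  assumes K: "open_convex_polygon K"
  shows "(\<Sum>e\<in>cell_edges K. edge_length e *\<^sub>R outward_normal K e) = 0" (is "?s = 0")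
proof -
  obtain p where p: "p \<in> K" using K by (auto simp: open_convex_polygon_def)
  obtain r where r: "0 < r" "ball p r \<subseteq> K"
    using K p unfolding open_convex_polygon_def open_contains_ball by blast
  define x where "x e = (SOME z. z \<in> e)" for e :: edge
  have x: "x e \<in> e" if "e \<in> cell_edges K" for e
  proof -
    obtain a b where "e = closed_segment a b" using cell_edge_segment[OF K \<open>e \<in> cell_edges K\<close>] .
    then show ?thesis unfolding x_def by (metis ends_in_segment(1) someI)
  qed
  have moment: "2 * area K = (\<Sum>e\<in>cell_edges K. edge_length e * (x e \<bullet> outward_normal K e)) - q \<bullet> ?s"
    if "q \<in> K" for q
    by (subst polygon_area[OF K that x])
       (simp_all add: inner_diff_left inner_sum_right right_diff_distrib sum_subtractf)
  \<comment> \<open>A step in the direction of the sum, short enough to stay in the ball of radius \<open>r\<close> around \<open>p\<close>.\<close>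
  define t where "t = r / (2 * (norm ?s + 1))"
  have t: "0 < t" using r by (auto simp: t_def intro!: divide_pos_pos add_nonneg_pos)
  have "t * norm ?s < r"
    using r(1) unfolding t_def
    by (simp add: divide_simps add_nonneg_pos)
  then have "p + t *\<^sub>R ?s \<in> K" using r t by (auto simp: dist_norm)
  from moment[OF this] moment[OF p] have "t * (?s \<bullet> ?s) = 0"
    by (simp add: inner_add_left)
  then show ?thesis using t by simp
qed

lemma edge_length_pos:
  assumes "open_convex_polygon K" "e \<in> cell_edges K"
  shows "0 < edge_length e"
  using cell_edge_segment[OF assms] by (metis edge_length_def diameter_closed_segment zero_less_dist_iff)

lemma area_pos:
  assumes "open_convex_polygon K"
  shows "0 < area K"
proof -
  have "open K" "K \<noteq> {}" using assms by (auto simp: open_convex_polygon_def)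
  then have "\<not> negligible K" by (rule open_not_negligible)
  then have "measure lebesgue K \<noteq> 0"
    using polygon_measurable[OF assms] by (auto simp: negligible_iff_measure0)
  then show ?thesis unfolding area_def by (simp add: zero_less_measure_iff)
qed

section \<open>Limited averages and their decomposition\<close>

lemma local_space_integrable:
  assumes K: "open_convex_polygon K" and W: "local_space k K W" and \<phi>: "\<phi> \<in> W"
  shows "\<phi> integrable_on K"
proof -
  obtain B where B: "finite B" "\<And>b. b \<in> B \<Longrightarrow> smooth_up_to_boundary K b"
    "W = {\<phi>. \<exists>c. \<phi> = (\<lambda>x. \<Sum>b\<in>B. c b *\<^sub>R b x)}"
    using W unfolding local_space_def by blast
  have "continuous_on (closure K) b" if "b \<in> B" for b
    using B(2)[OF that] unfolding smooth_up_to_boundary_def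
    by (metis Ck_on.simps(1) continuous_on_subset)
  then have "continuous_on (closure K) \<phi>"
    using \<phi> by (auto simp: B(3) intro!: continuous_intros)
  moreover have "compact (closure K)" using polygon_bounded[OF K] by (simp add: compact_closure)
  ultimately have "set_integrable lborel (closure K) \<phi>"
    unfolding set_integrable_def by (intro borel_integrable_compact)
  then have "set_integrable lborel K \<phi>"
    by (rule set_integrable_subset) (use K in \<open>auto simp: open_convex_polygon_def closure_subset\<close>)
  then show ?thesis by (rule set_borel_integral_eq_integral(1))
qed

text \<open>The limiter rescales the deviation from the cell average, so for every scaling factor it keeps
  the average, provided that the field is integrable.\<close>

lemma cell_avg_limiter_Pi:
  assumes K: "open_convex_polygon K" and u: "u integrable_on K" "cell_avg K u = ubar"
  shows "cell_avg K (limiter_Pi lk G Q C K u ubar) = ubar"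
proof -
  define \<theta> where "\<theta> = limiter_theta lk G Q C K u ubar"
  have K': "K \<in> lmeasurable" and a: "area K \<noteq> 0"
    using polygon_measurable[OF K] area_pos[OF K] by auto
  have const: "integral K (\<lambda>x. c) = area K *\<^sub>R c" for c :: "real^'a"
  proof -
    have "integral K (\<lambda>x. (1::real) *\<^sub>R c) = integral K (\<lambda>x. 1) *\<^sub>R c"
      by (rule integral_unique, rule has_integral_scaleR_left, rule integrable_integral,
          rule integrable_on_const[OF K'])
    then show ?thesis by (simp add: area_def lmeasure_integral[OF K'])
  qed
  have int: "integral K u = area K *\<^sub>R ubar"
    using u(2) a by (auto simp: cell_avg_def)
  have "limiter_Pi lk G Q C K u ubar = (\<lambda>x. (1 - \<theta>) *\<^sub>R ubar + \<theta> *\<^sub>R u x)"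
    by (simp add: limiter_Pi_def \<theta>_def algebra_simps fun_eq_iff)
  moreover have "integral K (\<lambda>x. (1 - \<theta>) *\<^sub>R ubar + \<theta> *\<^sub>R u x) = area K *\<^sub>R ubar"
    by (subst integral_add)
      (simp_all add: const int u(1) integrable_on_const[OF K'] integrable_cmul algebra_simps)
  ultimately show ?thesis using a by (simp add: cell_avg_def)
qed

text \<open>The cell average is a convex combination of the edge traces and of one interior state in \<open>G\<close>.
  Seen from a half-space that contains \<open>G\<close>, the interior state contributes a nonnegative amount and may be
  dropped. If the edge weights already add up to one, there is no interior state to speak of;
  then the decomposition and the exactness of the edge quadrature, both applied to the limited
  reconstruction, give the cell average as the combination of the edge traces alone.\<close>

lemma cell_average_above_edge_average:
  fixes us N :: "real^'m::finite"
  assumes cad: "cell_average_decomposition \<T> V C"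
    and quad: "edge_quadrature \<T> \<W> Q"
    and K: "K \<in> \<T>" "finite (cell_edges K)"
    and adm: "G_admissible G Q C \<W> K ubar uh"
    and full: "lam_sum C K = 1 \<Longrightarrow> V K = \<W> K \<and> cell_avg K uh = ubar"
    and half: "\<And>v. v \<in> G \<Longrightarrow> 0 \<le> (v - us) \<bullet> N"
  shows "(\<Sum>e\<in>cell_edges K. lam C K e * (\<Sum>\<nu>=1..qn Q. qw Q e \<nu> * ((uh (qx Q e \<nu>) - us) \<bullet> N)))
    \<le> (ubar - us) \<bullet> N"
proof -
  define A where "A = (\<Sum>e\<in>cell_edges K. lam C K e *\<^sub>R (\<Sum>\<nu>=1..qn Q. qw Q e \<nu> *\<^sub>R uh (qx Q e \<nu>)))"
  have bet: "\<And>s. s < intn C K \<Longrightarrow> 0 < bet C K s" and total: "lam_sum C K + (\<Sum>s<intn C K. bet C K s) = 1"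
    and decomp: "\<And>\<phi>. \<phi> \<in> V K \<Longrightarrow> cell_avg K \<phi> = (\<Sum>e\<in>cell_edges K. lam C K e *\<^sub>R edge_avg e \<phi>) +
           (\<Sum>s<intn C K. bet C K s *\<^sub>R \<phi> (intx C K s))"
    using cad K(1) unfolding cell_average_decomposition_def by blast+
  have weights: "(\<Sum>\<nu>=1..qn Q. qw Q e \<nu>) = 1" if "e \<in> cell_edges K" for e
    using quad K(1) that unfolding edge_quadrature_def mesh_edges_def by blast
  have uhW: "uh \<in> \<W> K" and inner: "lam_sum C K < 1 \<Longrightarrow> (1 / (1 - lam_sum C K)) *\<^sub>R (ubar - A) \<in> G"
    using adm unfolding G_admissible_def A_def by blast+
  have "(\<Sum>\<nu>=1..qn Q. qw Q e \<nu> * ((uh (qx Q e \<nu>) - us) \<bullet> N))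
      = (\<Sum>\<nu>=1..qn Q. qw Q e \<nu> *\<^sub>R uh (qx Q e \<nu>)) \<bullet> N - us \<bullet> N" if "e \<in> cell_edges K" for e
  proof -
    have "(\<Sum>\<nu>=1..qn Q. qw Q e \<nu> * (us \<bullet> N)) = us \<bullet> N"
      by (simp only: weights[OF that] mult_1_left flip: sum_distrib_right)
    then show ?thesis
      by (simp add: inner_diff_left inner_sum_left right_diff_distrib sum_subtractf)
  qed
  then have edge_part: "(\<Sum>e\<in>cell_edges K. lam C K e * (\<Sum>\<nu>=1..qn Q. qw Q e \<nu> * ((uh (qx Q e \<nu>) - us) \<bullet> N)))
      = A \<bullet> N - lam_sum C K * (us \<bullet> N)"
    by (simp add: A_def lam_sum_def inner_sum_left right_diff_distrib sum_subtractf sum_distrib_right)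
  have nonneg: "0 \<le> (\<Sum>s<intn C K. bet C K s)" using bet by (intro sum_nonneg) (auto simp: less_imp_le)
  show ?thesis
  proof (cases "lam_sum C K < 1")
    case True
    define v where "v = (1 / (1 - lam_sum C K)) *\<^sub>R (ubar - A)"
    have "ubar = A + (1 - lam_sum C K) *\<^sub>R v" using True by (simp add: v_def)
    then have "ubar \<bullet> N = A \<bullet> N + (1 - lam_sum C K) * (v \<bullet> N)"
      by (metis inner_add_left inner_scaleR_left)
    then have "(ubar - us) \<bullet> N = A \<bullet> N - lam_sum C K * (us \<bullet> N) + (1 - lam_sum C K) * ((v - us) \<bullet> N)"
      by (simp add: inner_diff_left algebra_simps)
    moreover have "0 \<le> (1 - lam_sum C K) * ((v - us) \<bullet> N)"
      using True half inner[OF True] by (simp add: v_def)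
    ultimately show ?thesis using edge_part by simp
  next
    case False
    then have one: "lam_sum C K = 1" and zero: "(\<Sum>s<intn C K. bet C K s) = 0" using total nonneg by auto
    have "intn C K = 0"
    proof (rule ccontr)
      assume "intn C K \<noteq> 0"
      then have "0 < (\<Sum>s<intn C K. bet C K s)" using bet by (intro sum_pos) auto
      then show False using zero by simp
    qed
    then have "ubar = (\<Sum>e\<in>cell_edges K. lam C K e *\<^sub>R edge_avg e uh)"
      using decomp[of uh] full[OF one] uhW by simp
    also have "\<dots> = A"
      unfolding A_def using quad K(1) uhW unfolding edge_quadrature_def
      by (intro sum.cong refl) metis
    finally show ?thesis using edge_part one by (simp add: inner_diff_left)
  qed
qed

section \<open>The conservative update\<close>

text \<open>The splitting condition with the lower sign, applied to both traces, bounds their normal fluxes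
  from above. The numerical dissipation cancels the contribution of the exterior trace and doubles that of
  the interior one, so that only interior values remain, up to the term with \<open>\<zeta>\<close>.\<close>

lemma weak_LF_flux_bound:
  assumes split: "weak_LF_splitting J g G f ws \<zeta>"
    and j: "j \<in> J" "us \<in> contact_set G g j" and n: "norm n = 1"
    and um: "um \<in> G" "ws um n \<le> \<alpha>" and up: "up \<in> G" "ws up n \<le> \<alpha>"
  shows "((1/2) *\<^sub>R (normal_flux f um n + normal_flux f up n) - (\<alpha> / 2) *\<^sub>R (up - um)) \<bullet> grad (g j) us
    \<le> \<alpha> * ((um - us) \<bullet> grad (g j) us) - \<zeta> j us \<bullet> n"
proof -
  have "normal_flux f u n \<bullet> grad (g j) us \<le> \<alpha> * ((u - us) \<bullet> grad (g j) us) - \<zeta> j us \<bullet> n"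
    if "u \<in> G" "ws u n \<le> \<alpha>" for u
    using split j n that unfolding weak_LF_splitting_def by (smt (verit))
  from this[OF um] this[OF up] show ?thesis
    by (simp add: inner_diff_left inner_add_left algebra_simps)
qed

lemma exterior_trace_in_G:
  assumes bdry: "boundary_states \<T> G Ufwd Q bst"
    and adm: "\<forall>K\<in>\<T>. G_admissible G Q C \<W> K (fst u K) (uhat K)"
    and dom: "u \<in> hybrid_domain \<T> G Ufwd"
    and K: "K \<in> \<T>" "e \<in> cell_edges K" "\<nu> \<in> {1..qn Q}"
  shows "exterior_trace \<T> Q bst u uhat K e \<nu> \<in> G"
proof (cases "has_neighbour \<T> K e")
  case True
  then have "\<exists>K'. K' \<in> \<T> \<and> K' \<noteq> K \<and> e \<in> cell_edges K'" by (auto simp: has_neighbour_def)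
  then have "neighbour \<T> K e \<in> \<T> \<and> neighbour \<T> K e \<noteq> K \<and> e \<in> cell_edges (neighbour \<T> K e)"
    unfolding neighbour_def by (rule someI_ex)
  then show ?thesis
    using adm K(3) True unfolding exterior_trace_def G_admissible_def by auto
next
  case False
  then show ?thesis
    using bdry dom K unfolding exterior_trace_def boundary_states_def by auto
qed

text \<open>The flux bounds make the updated average, seen from the half-space, at least the sum of
  the interior traces with coefficients \<open>lam C K e - dt * edge_length e * \<alpha> K e \<nu> / area K\<close> times the
  quadrature weights. The time step restriction makes these coefficients nonnegative. The vector
  \<open>z\<close> is the same on all edges, so its contributions add up to its inner product with
  the sum of the scaled normals, which is zero.\<close>

lemma average_update_in_half_space:
  fixes N us :: "real^'m::finite"
  assumes K: "open_convex_polygon K" and dt: "0 < dt"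
    and decomp: "(\<Sum>e\<in>cell_edges K. lam C K e * (\<Sum>\<nu>=1..qn Q. qw Q e \<nu> * ((uhat K (qx Q e \<nu>) - us) \<bullet> N)))
      \<le> (fst u K - us) \<bullet> N"
    and weights: "\<And>e. e \<in> cell_edges K \<Longrightarrow> (\<Sum>\<nu>=1..qn Q. qw Q e \<nu>) = 1"
      "\<And>e \<nu>. e \<in> cell_edges K \<Longrightarrow> \<nu> \<in> {1..qn Q} \<Longrightarrow> 0 < qw Q e \<nu>"
    and trace: "\<And>e \<nu>. e \<in> cell_edges K \<Longrightarrow> \<nu> \<in> {1..qn Q} \<Longrightarrow> 0 \<le> (uhat K (qx Q e \<nu>) - us) \<bullet> N"
    and cfl: "\<And>e \<nu>. e \<in> cell_edges K \<Longrightarrow> \<nu> \<in> {1..qn Q} \<Longrightarrow> dt * \<alpha> K e \<nu> \<le> cad_mu C K"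
    and flux: "\<And>e \<nu>. e \<in> cell_edges K \<Longrightarrow> \<nu> \<in> {1..qn Q} \<Longrightarrow>
      (let um = uhat K (qx Q e \<nu>); up = exterior_trace \<T> Q bst u uhat K e \<nu>; n = outward_normal K e in
         (1/2) *\<^sub>R (normal_flux f um n + normal_flux f up n) - (\<alpha> K e \<nu> / 2) *\<^sub>R (up - um)) \<bullet> N
      \<le> \<alpha> K e \<nu> * ((uhat K (qx Q e \<nu>) - us) \<bullet> N) - z \<bullet> outward_normal K e"
  shows "0 \<le> (average_update \<T> Q f bst \<alpha> dt u uhat K - us) \<bullet> N"
proof -
  define E where "E = cell_edges K"
  define I where "I = {1..qn Q}"
  define h where "h e \<nu> = (let um = uhat K (qx Q e \<nu>); up = exterior_trace \<T> Q bst u uhat K e \<nu>; n = outward_normal K e in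
         (1/2) *\<^sub>R (normal_flux f um n + normal_flux f up n) - (\<alpha> K e \<nu> / 2) *\<^sub>R (up - um))" for e \<nu>
  define d where "d e \<nu> = (uhat K (qx Q e \<nu>) - us) \<bullet> N" for e \<nu>
  define c where "c = dt / area K"
  have c: "0 < c" using dt area_pos[OF K] by (simp add: c_def)
  have len: "0 < edge_length e" if "e \<in> E" for e
    using edge_length_pos[OF K] that by (simp add: E_def)
  have mu: "c * edge_length e * \<alpha> K e \<nu> \<le> lam C K e" if "e \<in> E" "\<nu> \<in> I" for e \<nu>
  proof -
    have "dt * \<alpha> K e \<nu> \<le> lam C K e * area K / edge_length e"
      using cfl[of e \<nu>] that finite_cell_edges[OF K] unfolding cad_mu_def E_def I_def
      by (force intro: order_trans Min_le)
    then show ?thesis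
      using len[OF that(1)] area_pos[OF K] by (simp add: c_def field_simps)
  qed
  have closed: "(\<Sum>e\<in>E. edge_length e * (z \<bullet> outward_normal K e)) = 0"
    using arg_cong[OF polygon_closed[OF K], of "\<lambda>x. z \<bullet> x"] by (simp add: inner_sum_right E_def)
  have bound: "(\<Sum>e\<in>E. edge_length e * (\<Sum>\<nu>\<in>I. qw Q e \<nu> * (h e \<nu> \<bullet> N)))
      \<le> (\<Sum>e\<in>E. edge_length e * (\<Sum>\<nu>\<in>I. qw Q e \<nu> * (\<alpha> K e \<nu> * d e \<nu>)))"
  proof -
    have "(\<Sum>e\<in>E. edge_length e * (\<Sum>\<nu>\<in>I. qw Q e \<nu> * (h e \<nu> \<bullet> N)))
      \<le> (\<Sum>e\<in>E. edge_length e * (\<Sum>\<nu>\<in>I. qw Q e \<nu> * (\<alpha> K e \<nu> * d e \<nu> - z \<bullet> outward_normal K e)))"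
      using flux weights(2) len
      by (intro sum_mono mult_left_mono) (auto simp: h_def d_def E_def I_def less_imp_le)
    also have "\<dots> = (\<Sum>e\<in>E. edge_length e * ((\<Sum>\<nu>\<in>I. qw Q e \<nu> * (\<alpha> K e \<nu> * d e \<nu>)) - z \<bullet> outward_normal K e))"
    proof (intro sum.cong refl arg_cong2[where f="(*)"])
      fix e assume "e \<in> E"
      then have "(\<Sum>\<nu>\<in>I. qw Q e \<nu> * (z \<bullet> outward_normal K e)) = z \<bullet> outward_normal K e"
        using weights(1) by (simp only: E_def I_def mult_1_left flip: sum_distrib_right)
      then show "(\<Sum>\<nu>\<in>I. qw Q e \<nu> * (\<alpha> K e \<nu> * d e \<nu> - z \<bullet> outward_normal K e))
        = (\<Sum>\<nu>\<in>I. qw Q e \<nu> * (\<alpha> K e \<nu> * d e \<nu>)) - z \<bullet> outward_normal K e"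
        by (simp add: right_diff_distrib sum_subtractf)
    qed
    also have "\<dots> = (\<Sum>e\<in>E. edge_length e * (\<Sum>\<nu>\<in>I. qw Q e \<nu> * (\<alpha> K e \<nu> * d e \<nu>)))"
      using closed by (simp add: right_diff_distrib sum_subtractf)
    finally show ?thesis .
  qed
  have "c * (\<Sum>e\<in>E. edge_length e * (\<Sum>\<nu>\<in>I. qw Q e \<nu> * (\<alpha> K e \<nu> * d e \<nu>)))
      = (\<Sum>e\<in>E. \<Sum>\<nu>\<in>I. (c * edge_length e * \<alpha> K e \<nu>) * (qw Q e \<nu> * d e \<nu>))"
    by (simp add: sum_distrib_left algebra_simps)
  also have "\<dots> \<le> (\<Sum>e\<in>E. \<Sum>\<nu>\<in>I. lam C K e * (qw Q e \<nu> * d e \<nu>))"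
    using mu trace weights(2)
    by (intro sum_mono mult_right_mono) (auto simp: E_def I_def d_def less_imp_le)
  also have "\<dots> = (\<Sum>e\<in>E. lam C K e * (\<Sum>\<nu>\<in>I. qw Q e \<nu> * d e \<nu>))"
    by (simp add: sum_distrib_left)
  also have "\<dots> \<le> (fst u K - us) \<bullet> N"
    using decomp by (simp add: E_def I_def d_def)
  finally have "c * (\<Sum>e\<in>E. edge_length e * (\<Sum>\<nu>\<in>I. qw Q e \<nu> * (h e \<nu> \<bullet> N))) \<le> (fst u K - us) \<bullet> N"
    using mult_left_mono[OF bound less_imp_le[OF c]] by linarith
  moreover have "average_update \<T> Q f bst \<alpha> dt u uhat K
      = fst u K - c *\<^sub>R (\<Sum>e\<in>E. edge_length e *\<^sub>R (\<Sum>\<nu>\<in>I. qw Q e \<nu> *\<^sub>R h e \<nu>))"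
    unfolding average_update_def c_def E_def I_def h_def ..
  ultimately show ?thesis
    by (simp add: inner_diff_left inner_sum_left)
qed

theorem corollary3p9:
  fixes \<Omega> :: "point set" and \<T> :: "cell set" and \<rho> :: real and N k :: nat
    and D :: "(real^'m::finite) set" and f :: "2 \<Rightarrow> real^'m \<Rightarrow> real^'m"
    and J :: "'j set" and g :: "'j \<Rightarrow> real^'m \<Rightarrow> real" and G :: "(real^'m) set"
    and \<W> :: "cell \<Rightarrow> 'm field set" and \<R> :: "cell \<Rightarrow> 'm hybrid \<Rightarrow> 'm field"
    and Q :: quadrature and C :: cad and lk :: "cell \<Rightarrow> limiter"
    and ws :: "real^'m \<Rightarrow> point \<Rightarrow> real" and \<zeta> :: "'j \<Rightarrow> real^'m \<Rightarrow> point"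
    and bst :: "edge \<Rightarrow> nat \<Rightarrow> 'm hybrid \<Rightarrow> real^'m"
    and \<alpha> :: "cell \<Rightarrow> edge \<Rightarrow> nat \<Rightarrow> real"
    and Tm B :: "real^'m \<Rightarrow> real^'m" and Ufwd Gpt :: "(real^'m) set"
    and P :: "'m point_data"
    and dt :: real and u u' :: "'m hybrid" and uhat :: "cell \<Rightarrow> 'm field"
    and w :: "point \<Rightarrow> real^'m"
  assumes mesh: "conforming_mesh \<Omega> \<T>" "shape_regular \<rho> N \<T>"
    and pde: "open D" "hyperbolic_on D f" "Ufwd \<subseteq> D"
    and spaces: "\<forall>K\<in>\<T>. local_space k K (\<W> K)"
    and recon: "reconstruction \<T> \<W> \<R>"
    and quad: "edge_quadrature \<T> \<W> Q"
    and dom: "invariant_domain J g G"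
    and cad: "cell_average_decomposition \<T> (cad_space lk k \<W>) C"
    and cad_no_interior: "\<forall>K\<in>\<T>. lam_sum C K = 1 \<longrightarrow> cad_space lk k \<W> K = \<W> K"
    and splitting: "weak_LF_splitting J g G f ws \<zeta>"
    and bdry: "boundary_states \<T> G Ufwd Q bst" "boundary_derivatives \<T> G Ufwd P"
    and point_data: "point_geometry \<T> P" "point_speeds \<T> f Tm P u"
    and fwd: "forward_map Ufwd Tm"
    and inv: "admissible_inverse Tm B Gpt" "Gpt \<subseteq> Ufwd"
    and point_in_fwd: "\<forall>\<sigma>\<in>nodes \<T>. snd u \<sigma> \<in> Ufwd"
    and stage_values: "\<forall>\<sigma>\<in>nodes \<T>. w \<sigma> = Tm (snd u \<sigma>) + dt *\<^sub>R point_operator \<T> f Tm \<R> P u \<sigma>"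
    and avg_in_G: "\<forall>K\<in>\<T>. fst u K \<in> G"
    and point_in_Gpt: "\<forall>\<sigma>\<in>nodes \<T>. snd u \<sigma> \<in> Gpt"
    and limited: "\<forall>K\<in>\<T>. uhat K = limiter_Pi lk G Q C K (\<R> K u) (fst u K)"
    and admissible: "\<forall>K\<in>\<T>. G_admissible G Q C \<W> K (fst u K) (uhat K)"
    and viscosity: "viscosity_bound \<T> Q bst ws u uhat \<alpha>"
    and viscosity_cfl: "\<forall>K\<in>\<T>. \<forall>e\<in>cell_edges K. \<forall>\<nu>\<in>{1..qn Q}. dt * \<alpha> K e \<nu> \<le> cad_mu C K"
    and dt_pos: "0 < dt"
    and cfl: "ereal dt \<le> (MIN K\<in>\<T>. ereal (cad_mu C K) / ereal (2 * max_wave_speed Q ws uhat K))"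
    and avg_step: "\<forall>K\<in>\<T>. fst u' K = average_update \<T> Q f bst \<alpha> dt u uhat K"
    and point_step: "\<forall>\<sigma>\<in>nodes \<T>. snd u' \<sigma> = B (w \<sigma>)"
  shows "(\<forall>K\<in>\<T>. fst u' K \<in> G) \<and> (\<forall>\<sigma>\<in>nodes \<T>. snd u' \<sigma> \<in> Gpt)"
proof (intro conjI ballI)
  fix \<sigma> assume "\<sigma> \<in> nodes \<T>"
  then show "snd u' \<sigma> \<in> Gpt"
    using point_step inv(1) by (auto simp: admissible_inverse_def)
next
  fix K assume K: "K \<in> \<T>"
  have poly: "open_convex_polygon K" using mesh(1) K by (auto simp: conforming_mesh_def)
  have G: "G = {v. \<forall>j\<in>J. \<forall>us\<in>contact_set G g j. 0 \<le> (v - us) \<bullet> grad (g j) us}"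
    using dom unfolding invariant_domain_def by blast
  have domain: "u \<in> hybrid_domain \<T> G Ufwd"
    using avg_in_G point_in_fwd by (simp add: hybrid_domain_def)
  have adm: "G_admissible G Q C \<W> K (fst u K) (uhat K)" using admissible K by blast
  have trace: "uhat K (qx Q e \<nu>) \<in> G" if "e \<in> cell_edges K" "\<nu> \<in> {1..qn Q}" for e \<nu>
    using adm that unfolding G_admissible_def by blast
  have weights: "(\<Sum>\<nu>=1..qn Q. qw Q e \<nu>) = 1" "\<And>\<nu>. \<nu> \<in> {1..qn Q} \<Longrightarrow> 0 < qw Q e \<nu>"
    if "e \<in> cell_edges K" for e
    using quad K that unfolding edge_quadrature_def mesh_edges_def by blast+
  \<comment> \<open>This identity matters for a decomposition without interior nodes, where the average has to be
    recovered from the edge traces.\<close>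
  have average: "cell_avg K (uhat K) = fst u K"
  proof -
    have "\<R> K u \<in> \<W> K" "cell_avg K (\<R> K u) = fst u K"
      using recon K unfolding reconstruction_def by blast+
    then show ?thesis
      using limited K cell_avg_limiter_Pi[OF poly local_space_integrable[OF poly]] spaces by metis
  qed
  have "0 \<le> (average_update \<T> Q f bst \<alpha> dt u uhat K - us) \<bullet> grad (g j) us"
    if j: "j \<in> J" "us \<in> contact_set G g j" for j us
  proof (rule average_update_in_half_space[OF poly dt_pos, where z="\<zeta> j us" and C=C])
    have half: "0 \<le> (v - us) \<bullet> grad (g j) us" if "v \<in> G" for v
      using that j by (subst (asm) G) blast
    show "(\<Sum>e\<in>cell_edges K. lam C K e * (\<Sum>\<nu>=1..qn Q. qw Q e \<nu> * ((uhat K (qx Q e \<nu>) - us) \<bullet> grad (g j) us)))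
      \<le> (fst u K - us) \<bullet> grad (g j) us"
      using cad_no_interior K average
      by (intro cell_average_above_edge_average[OF cad quad K finite_cell_edges[OF poly] adm _ half]) auto
    fix e \<nu> assume e: "e \<in> cell_edges K" and \<nu>: "\<nu> \<in> {1..qn Q}"
    show "0 \<le> (uhat K (qx Q e \<nu>) - us) \<bullet> grad (g j) us" by (rule half[OF trace[OF e \<nu>]])
    show "dt * \<alpha> K e \<nu> \<le> cad_mu C K" using viscosity_cfl K e \<nu> by blast
    have "ws (uhat K (qx Q e \<nu>)) (outward_normal K e) \<le> \<alpha> K e \<nu>"
      "ws (exterior_trace \<T> Q bst u uhat K e \<nu>) (outward_normal K e) \<le> \<alpha> K e \<nu>"
      using viscosity K e \<nu> unfolding viscosity_bound_def by force+
    then show "(let um = uhat K (qx Q e \<nu>); up = exterior_trace \<T> Q bst u uhat K e \<nu>; n = outward_normal K e in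
         (1/2) *\<^sub>R (normal_flux f um n + normal_flux f up n) - (\<alpha> K e \<nu> / 2) *\<^sub>R (up - um)) \<bullet> grad (g j) us
      \<le> \<alpha> K e \<nu> * ((uhat K (qx Q e \<nu>) - us) \<bullet> grad (g j) us) - \<zeta> j us \<bullet> outward_normal K e"
      unfolding Let_def
      by (intro weak_LF_flux_bound[OF splitting j norm_outward_normal[OF poly e] trace[OF e \<nu>] _
          exterior_trace_in_G[OF bdry(1) admissible domain K e \<nu>]])
  qed (use weights in auto)
  then show "fst u' K \<in> G"
    using avg_step K by (subst G) simp
qed

end
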